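(* Let $m,n\ge 0$ be integers. The set of morphisms from the oriental $\mathcal{O}_m$ to the oriental $\mathcal{O}_n$ is naturally isomorphic to the subset of $\mathbf{Z}\Delta(m,n)$ consisting of the linear combinations $x$ such that (1) the sum of the coefficients in $x$ is $1$; (2) for all injective morphisms $f$ in $\Delta$ with codomain $m$, the coefficients of the injective morphisms in the composite $x\circ f$ are nonnegative.
   Context: Simplex category. The objects of $\Delta$ are the integers $0,1,2,\dots$; $\Delta(m,n)$ is the set of non-decreasing functions $f\colon\{0,\dots,m\}\to\{0,\dots,n\}$, written as tuples $(f_0,\dots,f_m)$ with $0\le f_0\le\dots\le f_m\le n$, with the usual composition. $\mathbf{Z}\Delta$ is the category with the same objects in which $\mathbf{Z}\Delta(m,n)$ is the free abelian group with basis $\Delta(m,n)$; composition is extended bilinearly. Simplex chain complexes. $K[n]$ is the augmented chain complex of free abelian groups where $K[n]_q$ has prescribed basis the tuples of integers $[a_0,\dots,a_q]$ with $0\le a_0<\dots<a_q\le n$, with $\partial[a_0,\dots,a_q]=\sum_{i=0}^q(-1)^i[a_0,\dots,a_{i-1},a_{i+1},\dots,a_q]$ for $q>0$ and augmentation $\epsilon[a_0]=1$. A chain $c\in K[n]_q$ satisfies $c\ge 0$ iff it is a sum of basis elements (i.e. all its coefficients are nonnegative). A morphism $f=(f_0,\dots,f_m)\in\Delta(m,n)$ induces a chain map $K[m]\to K[n]$ by $f[a(0),\dots,a(q)]=[f_{a(0)},\dots,f_{a(q)}]$ if $f_{a(0)}<\dots<f_{a(q)}$, and $f[a(0),\dots,a(q)]=0$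 if $f_{a(0)},\dots,f_{a(q)}$ are not distinct; by linearity every $x\in\mathbf{Z}\Delta(m,n)$ induces a chain map $K[m]\to K[n]$, functorially. Strict $\omega$-categories are used in Street's one-sorted form: a single set which is the set of morphisms of a category for each $p\ge 0$, with left and right identity operations $d^-_p,d^+_p$ and composition $\#_p$ (where $x\mathbin{\#_p}y$ is defined when $d^+_px=d^-_py$), satisfying the usual strict $\omega$-category axioms; morphisms of $\omega$-categories are functions preserving all $d^\pm_p$ and $\#_p$. Orientals. The $n$th oriental $\mathcal{O}_n$ (Street's oriented $n$-simplex) is identified with the following $\omega$-category $\nu K[n]$. Its members are the double sequences $x=(x^-_0,x^+_0\mid x^-_1,x^+_1\mid\dots)$ such that: $x^-_q,x^+_q\in K[n]_q$; there is $N$ with $x^-_q=x^+_q=0$ for $q>N$; $x^+_q-x^-_q=\partial x^-_{q+1}=\partial x^+_{q+1}$ for $q\ge0$; $x^-_q\ge0$ and $x^+_q\ge 0$ for $q\ge 0$; $\epsilon x^-_0=\epsilon x^+_0=1$. The operations are $d^-_px=(x^-_0,x^+_0\mid\dots\mid x^-_{p-1},x^+_{p-1}\mid x^-_p,x^-_p\mid0,0\mid\dots)$, $d^+_px=(x^-_0,x^+_0\mid\dots\mid x^-_{p-1},x^+_{p-1}\mid x^+_p,x^+_p\mid0,0\mid\dots)$, and, if $d^+_px=d^-_py=w$, $x\mathbin{\#_p}y=x-w+y$ (termwise). "Naturally isomorphic" means: the bijection sends such an $x\in\mathbf{Z}\Delta(m,n)$ to the $\omega$-category morphism $\mathcal{O}_m=\nu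 K[m]\to\nu K[n]=\mathcal{O}_n$ obtained by applying termwise the chain map $K[m]\to K[n]$ induced by $x$; in particular it is compatible with composition. *)

theory Defs
  imports "HOL-Library.Poly_Mapping" "HOL-Library.FuncSet"
begin

(* Free abelian groups are the type 'a =>_0 int of finitely supported functions, with basis
   elements frag_of a and linear extension frag_extend (from HOL-Library.Poly_Mapping). *)

definition coeff_sum :: "('a \<Rightarrow>\<^sub>0 int) \<Rightarrow> int" where
  "coeff_sum x = (\<Sum>a\<in>Poly_Mapping.keys x. Poly_Mapping.lookup x a)"


section \<open>The simplex category and its linearisation\<close>

(* The tuple (f_0,...,f_m) is the list f with f ! i = f_i. *)

definition Delta :: "nat \<Rightarrow> nat \<Rightarrow> nat list set" where
  "Delta m n = {f. length f = Suc m \<and> sorted f \<and> set f \<subseteq> {0..n}}"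

definition delta_comp :: "nat list \<Rightarrow> nat list \<Rightarrow> nat list" where
  "delta_comp g f = map (\<lambda>i. g ! i) f"

definition ZDelta :: "nat \<Rightarrow> nat \<Rightarrow> (nat list \<Rightarrow>\<^sub>0 int) set" where
  "ZDelta m n = {x. Poly_Mapping.keys x \<subseteq> Delta m n}"

definition zdelta_comp ::
  "(nat list \<Rightarrow>\<^sub>0 int) \<Rightarrow> (nat list \<Rightarrow>\<^sub>0 int) \<Rightarrow> (nat list \<Rightarrow>\<^sub>0 int)" where
  "zdelta_comp x y = frag_extend (\<lambda>g. frag_extend (\<lambda>f. frag_of (delta_comp g f)) y) x"

lemma delta_comp_closed:
  assumes "g \<in> Delta m n" "f \<in> Delta l m"
  shows "delta_comp g f \<in> Delta l n"
proof -
  have g: "length g = Suc m" "sorted g" "set g \<subseteq> {0..n}"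
    and f: "length f = Suc l" "sorted f" "set f \<subseteq> {0..m}"
    using assms by (auto simp: Delta_def)
  have lt: "f ! j < length g" if "j < length f" for j
    using f(3) g(1) nth_mem[OF that] by auto
  have "sorted (map (\<lambda>i. g ! i) f)"
    unfolding sorted_iff_nth_mono
    using lt f(2) g(2) by (auto simp: sorted_iff_nth_mono)
  moreover have "g ! i \<in> {0..n}" if "i \<in> set f" for i
  proof -
    have "i < length g" using that g(1) f(3) by auto
    then show ?thesis using g(3) nth_mem by blast
  qed
  ultimately show ?thesis
    using f(1) by (auto simp: Delta_def delta_comp_def)
qed


section \<open>The augmented chain complexes of simplexes\<close>

definition simplex_basis :: "nat \<Rightarrow> nat \<Rightarrow> nat list set" where
  "simplex_basis n q = {a. length a = Suc q \<and> sorted_wrt (<) a \<and> set a \<subseteq> {0..n}}"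

definition simplex_chains :: "nat \<Rightarrow> nat \<Rightarrow> (nat list \<Rightarrow>\<^sub>0 int) set" where
  "simplex_chains n q = {c. Poly_Mapping.keys c \<subseteq> simplex_basis n q}"

definition chain_nonneg :: "(nat list \<Rightarrow>\<^sub>0 int) \<Rightarrow> bool" where
  "chain_nonneg c \<longleftrightarrow> (\<forall>a. 0 \<le> Poly_Mapping.lookup c a)"

(* Only meaningful on chains of positive degree. *)
definition simplex_boundary :: "(nat list \<Rightarrow>\<^sub>0 int) \<Rightarrow> (nat list \<Rightarrow>\<^sub>0 int)" where
  "simplex_boundary =
     frag_extend (\<lambda>a. \<Sum>i<length a. frag_cmul ((-1) ^ i) (frag_of (take i a @ drop (Suc i) a)))"

(* Only meaningful on chains of degree 0, where it is determined by [a_0] |-> 1. *)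
abbreviation simplex_aug :: "(nat list \<Rightarrow>\<^sub>0 int) \<Rightarrow> int" where
  "simplex_aug \<equiv> coeff_sum"

definition delta_act_basis :: "nat list \<Rightarrow> nat list \<Rightarrow> (nat list \<Rightarrow>\<^sub>0 int)" where
  "delta_act_basis f a =
     (if sorted_wrt (<) (map (\<lambda>i. f ! i) a) then frag_of (map (\<lambda>i. f ! i) a) else 0)"

definition zdelta_act ::
  "(nat list \<Rightarrow>\<^sub>0 int) \<Rightarrow> (nat list \<Rightarrow>\<^sub>0 int) \<Rightarrow> (nat list \<Rightarrow>\<^sub>0 int)" where
  "zdelta_act x c = frag_extend (\<lambda>f. frag_extend (delta_act_basis f) c) x"


section \<open>One-sorted strict omega-categories\<close>

datatype sign = Minus | Plus

(* comp C p x y is only meaningful when bd C Plus p x = bd C Minus p y. *)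
record 'a omega_struct =
  mor :: "'a set"
  bd :: "sign \<Rightarrow> nat \<Rightarrow> 'a \<Rightarrow> 'a"
  comp :: "nat \<Rightarrow> 'a \<Rightarrow> 'a \<Rightarrow> 'a"

locale omega_category =
  fixes C :: "'a omega_struct"
  assumes bd_closed: "x \<in> mor C \<Longrightarrow> bd C s p x \<in> mor C"
    and comp_closed:
      "\<lbrakk>x \<in> mor C; y \<in> mor C; bd C Plus p x = bd C Minus p y\<rbrakk> \<Longrightarrow> comp C p x y \<in> mor C"
    and bd_bd_same: "x \<in> mor C \<Longrightarrow> bd C s p (bd C t p x) = bd C t p x"
    and bd_Minus_comp:
      "\<lbrakk>x \<in> mor C; y \<in> mor C; bd C Plus p x = bd C Minus p y\<rbrakk>
        \<Longrightarrow> bd C Minus p (comp C p x y) = bd C Minus p x"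
    and bd_Plus_comp:
      "\<lbrakk>x \<in> mor C; y \<in> mor C; bd C Plus p x = bd C Minus p y\<rbrakk>
        \<Longrightarrow> bd C Plus p (comp C p x y) = bd C Plus p y"
    and left_identity: "x \<in> mor C \<Longrightarrow> comp C p (bd C Minus p x) x = x"
    and right_identity: "x \<in> mor C \<Longrightarrow> comp C p x (bd C Plus p x) = x"
    and comp_assoc:
      "\<lbrakk>x \<in> mor C; y \<in> mor C; z \<in> mor C;
        bd C Plus p x = bd C Minus p y; bd C Plus p y = bd C Minus p z\<rbrakk>
        \<Longrightarrow> comp C p (comp C p x y) z = comp C p x (comp C p y z)"
    and bd_lower_bd: "\<lbrakk>x \<in> mor C; q < p\<rbrakk> \<Longrightarrow> bd C s q (bd C t p x) = bd C s q x"
    and bd_bd_lower: "\<lbrakk>x \<in> mor C; q < p\<rbrakk> \<Longrightarrow> bd C t p (bd C s q x) = bd C s q x"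
    and bd_comp_lower:
      "\<lbrakk>x \<in> mor C; y \<in> mor C; q < p; bd C Plus q x = bd C Minus q y\<rbrakk>
        \<Longrightarrow> bd C s p (comp C q x y) = comp C q (bd C s p x) (bd C s p y)"
    and interchange:
      "\<lbrakk>x \<in> mor C; y \<in> mor C; z \<in> mor C; w \<in> mor C; q < p;
        bd C Plus q x = bd C Minus q y; bd C Plus q z = bd C Minus q w;
        bd C Plus p x = bd C Minus p z; bd C Plus p y = bd C Minus p w\<rbrakk>
        \<Longrightarrow> comp C p (comp C q x y) (comp C q z w) = comp C q (comp C p x z) (comp C p y w)"
    and finite_dimensional: "x \<in> mor C \<Longrightarrow> \<exists>p. \<forall>s. bd C s p x = x"

definition omega_hom :: "'a omega_struct \<Rightarrow> 'b omega_struct \<Rightarrow> ('a \<Rightarrow> 'b) set" where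
  "omega_hom C D =
     {F. omega_category C \<and> omega_category D \<and>
         F \<in> mor C \<rightarrow>\<^sub>E mor D \<and>
         (\<forall>x\<in>mor C. \<forall>s p. F (bd C s p x) = bd D s p (F x)) \<and>
         (\<forall>x\<in>mor C. \<forall>y\<in>mor C. \<forall>p. bd C Plus p x = bd C Minus p y \<longrightarrow>
            F (comp C p x y) = comp D p (F x) (F y))}"


section \<open>Orientals\<close>

(* x Minus q and x Plus q are the entries x^-_q and x^+_q. *)
type_synonym double_seq = "sign \<Rightarrow> nat \<Rightarrow> (nat list \<Rightarrow>\<^sub>0 int)"

definition oriental_mor :: "nat \<Rightarrow> double_seq set" where
  "oriental_mor n =
     {x. (\<forall>s q. x s q \<in> simplex_chains n q) \<and>
         (\<exists>N. \<forall>s. \<forall>q>N. x s q = 0) \<and>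
         (\<forall>s q. x Plus q - x Minus q = simplex_boundary (x s (Suc q))) \<and>
         (\<forall>s q. chain_nonneg (x s q)) \<and>
         (\<forall>s. simplex_aug (x s 0) = 1)}"

definition oriental_bd :: "sign \<Rightarrow> nat \<Rightarrow> double_seq \<Rightarrow> double_seq" where
  "oriental_bd s p x = (\<lambda>t q. if q < p then x t q else if q = p then x s p else 0)"

definition oriental_comp :: "nat \<Rightarrow> double_seq \<Rightarrow> double_seq \<Rightarrow> double_seq" where
  "oriental_comp p x y = (\<lambda>t q. x t q - oriental_bd Plus p x t q + y t q)"

definition oriental :: "nat \<Rightarrow> double_seq omega_struct" where
  "oriental n = \<lparr>mor = oriental_mor n, bd = oriental_bd, comp = oriental_comp\<rparr>"

lemma oriental_simps [simp]:
  "mor (oriental n) = oriental_mor n"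
  "bd (oriental n) = oriental_bd"
  "comp (oriental n) = oriental_comp"
  by (simp_all add: oriental_def)

lemma simplex_chains_0 [simp]: "0 \<in> simplex_chains n q"
  by (simp add: simplex_chains_def)

lemma simplex_chains_add:
  "c \<in> simplex_chains n q \<Longrightarrow> d \<in> simplex_chains n q \<Longrightarrow> c + d \<in> simplex_chains n q"
  unfolding simplex_chains_def using keys_add[of c d] by blast

lemma chain_nonneg_0 [simp]: "chain_nonneg 0"
  by (simp add: chain_nonneg_def)

lemma chain_nonneg_add: "chain_nonneg c \<Longrightarrow> chain_nonneg d \<Longrightarrow> chain_nonneg (c + d)"
  by (simp add: chain_nonneg_def lookup_add)

lemma simplex_boundary_0 [simp]: "simplex_boundary 0 = 0"
  by (simp add: simplex_boundary_def)

lemma simplex_boundary_add: "simplex_boundary (c + d) = simplex_boundary c + simplex_boundary d"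
  by (simp add: simplex_boundary_def frag_extend_add)

lemma oriental_bd_closed:
  assumes "x \<in> oriental_mor n"
  shows "oriental_bd s p x \<in> oriental_mor n"
  using assms unfolding oriental_mor_def oriental_bd_def
  by (cases s) (auto intro!: exI[of _ p])

lemma oriental_comp_apply:
  assumes "oriental_bd Plus p x = oriental_bd Minus p y"
  shows "oriental_comp p x y t q =
    (if q < p then x t q
     else if q = p then (case t of Minus \<Rightarrow> x Minus p | Plus \<Rightarrow> y Plus p)
     else x t q + y t q)"
proof -
  have "oriental_bd Plus p x t q = oriental_bd Minus p y t q" using assms by simp
  moreover have "oriental_bd Plus p x t p = oriental_bd Minus p y t p" using assms by simp
  ultimately show ?thesis
    by (auto simp: oriental_comp_def oriental_bd_def split: sign.splits if_splits)
qed

lemma oriental_composable_iff: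
  "oriental_bd Plus p x = oriental_bd Minus p y \<longleftrightarrow>
     (\<forall>t q. q < p \<longrightarrow> x t q = y t q) \<and> x Plus p = y Minus p"
  by (auto simp: oriental_bd_def fun_eq_iff)

lemma oriental_comp_closed:
  assumes x: "x \<in> oriental_mor n" and y: "y \<in> oriental_mor n"
    and c: "oriental_bd Plus p x = oriental_bd Minus p y"
  shows "oriental_comp p x y \<in> oriental_mor n"
proof -
  let ?z = "oriental_comp p x y"
  note z = oriental_comp_apply[OF c]
  have low: "\<And>t q. q < p \<Longrightarrow> x t q = y t q" and mid: "x Plus p = y Minus p"
    using c by (auto simp: oriental_composable_iff)
  have x': "\<And>s q. x s q \<in> simplex_chains n q" "\<And>s q. chain_nonneg (x s q)"
      "\<And>s. simplex_aug (x s 0) = 1"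
      "\<And>s q. x Plus q - x Minus q = simplex_boundary (x s (Suc q))"
    and y': "\<And>s q. y s q \<in> simplex_chains n q" "\<And>s q. chain_nonneg (y s q)"
      "\<And>s. simplex_aug (y s 0) = 1"
      "\<And>s q. y Plus q - y Minus q = simplex_boundary (y s (Suc q))"
    using x y by (auto simp: oriental_mor_def)
  obtain N M where "\<forall>s. \<forall>q>N. x s q = 0" "\<forall>s. \<forall>q>M. y s q = 0"
    using x y by (auto simp: oriental_mor_def)
  then have "\<forall>s. \<forall>q>max N M. ?z s q = 0"
    by (auto simp: z split: sign.splits)
  moreover have "?z s q \<in> simplex_chains n q" "chain_nonneg (?z s q)"
      "simplex_aug (?z s 0) = 1" for s q
    using x' y' by (auto simp: z simplex_chains_add chain_nonneg_add split: sign.splits)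
  moreover have "?z Plus q - ?z Minus q = simplex_boundary (?z s (Suc q))" for s q
  proof -
    consider "Suc q < p" | "Suc q = p" | "q = p" | "p < q" by linarith
    then show ?thesis
    proof cases
      case 1
      then show ?thesis using x'(4)[of q s] by (simp add: z)
    next
      case 2
      then have q: "q < p" by simp
      show ?thesis
      proof (cases s)
        case Minus
        then show ?thesis using 2 q x'(4)[of q Minus] by (simp add: z)
      next
        case Plus
        then show ?thesis using 2 q y'(4)[of q Plus] low[OF q] by (simp add: z)
      qed
    next
      case 3
      have "y Plus p - x Minus p = (x Plus p - x Minus p) + (y Plus p - y Minus p)"
        using mid by simp
      also have "\<dots> = simplex_boundary (x s (Suc p)) + simplex_boundary (y s (Suc p))"
        using x'(4)[of p s] y'(4)[of p s] by simp
      finally show ?thesis using 3 by (simp add: z simplex_boundary_add)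
    next
      case 4
      have "x Plus q + y Plus q - (x Minus q + y Minus q) =
            (x Plus q - x Minus q) + (y Plus q - y Minus q)" by simp
      also have "\<dots> = simplex_boundary (x s (Suc q)) + simplex_boundary (y s (Suc q))"
        using x'(4)[of q s] y'(4)[of q s] by simp
      finally show ?thesis using 4 by (simp add: z simplex_boundary_add)
    qed
  qed
  ultimately show ?thesis unfolding oriental_mor_def by blast
qed

lemma oriental_is_omega_category: "omega_category (oriental n)"
proof (unfold_locales, unfold oriental_simps)
  fix x y z w :: double_seq and p q :: nat and s t :: sign
  show "x \<in> oriental_mor n \<Longrightarrow> oriental_bd s p x \<in> oriental_mor n"
    by (rule oriental_bd_closed)
  show "oriental_comp p x y \<in> oriental_mor n"
    if "x \<in> oriental_mor n" "y \<in> oriental_mor n" "oriental_bd Plus p x = oriental_bd Minus p y"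
    using that by (rule oriental_comp_closed)
  show "oriental_bd s p (oriental_bd t p x) = oriental_bd t p x"
    by (auto simp: oriental_bd_def fun_eq_iff)
  show "oriental_bd Minus p (oriental_comp p x y) = oriental_bd Minus p x"
    if "oriental_bd Plus p x = oriental_bd Minus p y"
    unfolding fun_eq_iff oriental_bd_def[of Minus] oriental_comp_apply[OF that] by auto
  show "oriental_bd Plus p (oriental_comp p x y) = oriental_bd Plus p y"
    if c: "oriental_bd Plus p x = oriental_bd Minus p y"
  proof -
    have "\<And>t q. q < p \<Longrightarrow> x t q = y t q" using c by (auto simp: oriental_composable_iff)
    then show ?thesis
      by (auto simp: fun_eq_iff oriental_bd_def oriental_comp_apply[OF c])
  qed
  show "oriental_comp p (oriental_bd Minus p x) x = x"
    by (auto simp: oriental_bd_def oriental_comp_def fun_eq_iff)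
  show "oriental_comp p x (oriental_bd Plus p x) = x"
    by (auto simp: oriental_bd_def oriental_comp_def fun_eq_iff)
  show "oriental_comp p (oriental_comp p x y) z = oriental_comp p x (oriental_comp p y z)"
    if c: "oriental_bd Plus p x = oriental_bd Minus p y"
      and d: "oriental_bd Plus p y = oriental_bd Minus p z"
  proof -
    have low: "\<And>t q. q < p \<Longrightarrow> x t q = y t q" "\<And>t q. q < p \<Longrightarrow> y t q = z t q"
      and mid: "x Plus p = y Minus p" "y Plus p = z Minus p"
      using c d by (auto simp: oriental_composable_iff)
    show ?thesis
      by (auto simp: fun_eq_iff oriental_bd_def oriental_comp_def low mid algebra_simps)
  qed
  show "oriental_bd s q (oriental_bd t p x) = oriental_bd s q x" if "q < p"
    using that by (auto simp: oriental_bd_def fun_eq_iff)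
  show "oriental_bd t p (oriental_bd s q x) = oriental_bd s q x" if "q < p"
    using that by (auto simp: oriental_bd_def fun_eq_iff)
  show "oriental_bd s p (oriental_comp q x y) =
        oriental_comp q (oriental_bd s p x) (oriental_bd s p y)" if "q < p"
    using that by (auto simp: oriental_bd_def oriental_comp_def fun_eq_iff)
  show "oriental_comp p (oriental_comp q x y) (oriental_comp q z w) =
        oriental_comp q (oriental_comp p x z) (oriental_comp p y w)"
    if "q < p" "oriental_bd Plus q x = oriental_bd Minus q y"
      "oriental_bd Plus q z = oriental_bd Minus q w"
      "oriental_bd Plus p x = oriental_bd Minus p z"
      "oriental_bd Plus p y = oriental_bd Minus p w"
    using that(1)
    by (auto simp: oriental_bd_def oriental_comp_def fun_eq_iff algebra_simps)
  show "\<exists>p. \<forall>s. oriental_bd s p x = x" if "x \<in> oriental_mor n"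
  proof -
    have "\<exists>N. \<forall>s. \<forall>q>N. x s q = 0" using that unfolding oriental_mor_def by blast
    then obtain N where "\<forall>s. \<forall>q>N. x s q = 0" ..
    then have "\<forall>s. oriental_bd s (Suc N) x = x"
      by (auto simp: oriental_bd_def fun_eq_iff)
    then show ?thesis by blast
  qed
qed

definition oriental_map ::
  "nat \<Rightarrow> (nat list \<Rightarrow>\<^sub>0 int) \<Rightarrow> (double_seq \<Rightarrow> double_seq)" where
  "oriental_map m x = (\<lambda>u\<in>mor (oriental m). \<lambda>s q. zdelta_act x (u s q))"

definition oriental_coeffs :: "nat \<Rightarrow> nat \<Rightarrow> (nat list \<Rightarrow>\<^sub>0 int) set" where
  "oriental_coeffs m n =
     {x \<in> ZDelta m n.
        coeff_sum x = 1 \<and>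
        (\<forall>l. \<forall>f\<in>Delta l m. distinct f \<longrightarrow>
           (\<forall>g\<in>Delta l n. distinct g \<longrightarrow>
              0 \<le> Poly_Mapping.lookup (zdelta_comp x (frag_of f)) g))}"

end

theory Submission
  imports Defs "HOL-Library.Multiset"
begin

text \<open>A morphism \<open>F\<close> is turned into a chain map by sending a simplex to the top entry of the image of
  its atom. Every cell is a composite of atoms, and a composite is a termwise sum minus the common
  boundary cell, so \<open>F\<close> is the termwise application of this chain map. Cells are decomposed with the help of
  an order on simplexes for which input faces precede and output faces follow every simplex.

  Chain maps \<open>K[m] \<rightarrow> K[n]\<close> correspond to elements of \<open>\<int>\<Delta>(m,n)\<close>: a chain map is determined by its
  values on the simplexes with first vertex 0, and a monotone map \<open>f\<close> is encoded by the simplex of its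
  jumps together with its image, so that the values of \<open>x\<close> on these simplexes are
  computed by a unitriangular matrix. Conditions (1) and (2) express compatibility with the
  augmentation and nonnegativity.\<close>

section \<open>Chains and atoms\<close>

text \<open>Splitting an atom off a cell respects the boundary equations, but may produce negative
  coefficients. It succeeds only if the input of the atom is contained in the input of the cell; the
  order on simplexes provides an atom for which this holds. Prepending the vertex 0 contracts
  \<open>K[m]\<close>, which is why simplexes with first vertex 0 carry all the data of a chain map.
  Pairs of such a simplex and a simplex of \<open>K[n]\<close> of equal dimension correspond to
  monotone maps, so there are as many equations as unknown coefficients, and the unit diagonal makes
  the solution integral. Single coefficients of \<open>x\<close> may be negative: nonnegativity only
  concerns sums over all maps that send a given simplex to a given simplex.\<close>

lemma frag_linear_eqI:
  assumes "Poly_Mapping.keys c \<subseteq> S"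
    and "\<And>a. a \<in> S \<Longrightarrow> f (frag_of a) = (g (frag_of a) :: 'b::ab_group_add)"
    and "\<And>c d. f (c - d) = f c - f d" "\<And>c d. g (c - d) = g c - g d"
  shows "f c = g c"
  using assms(1)
proof (induction c rule: frag_induction)
  case zero
  show ?case using assms(3)[of 0 0] assms(4)[of 0 0] by simp
qed (use assms in auto)

lemma lookup_frag_extend:
  "Poly_Mapping.lookup (frag_extend b c) g =
    (\<Sum>a\<in>Poly_Mapping.keys c. Poly_Mapping.lookup c a * Poly_Mapping.lookup (b a) g)"
  by (simp add: frag_extend_def lookup_sum)

lemma frag_extend_swap:
  "frag_extend (\<lambda>f. frag_extend (b f) c) x = frag_extend (\<lambda>a. frag_extend (\<lambda>f. b f a) x) c"
  unfolding frag_extend_def frag_cmul_sum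
  by (subst sum.swap) (simp add: mult.commute)

lemma coeff_sum_eq: "finite S \<Longrightarrow> Poly_Mapping.keys c \<subseteq> S \<Longrightarrow> coeff_sum c = sum (Poly_Mapping.lookup c) S"
  unfolding coeff_sum_def by (rule sum.mono_neutral_left) (auto simp: in_keys_iff)

lemma coeff_sum_add: "coeff_sum (c + d) = coeff_sum c + coeff_sum d"
proof -
  let ?S = "Poly_Mapping.keys c \<union> Poly_Mapping.keys d"
  show ?thesis
    using keys_add[of c d]
    by (simp add: coeff_sum_eq[of ?S] lookup_add sum.distrib)
qed

lemma coeff_sum_0 [simp]: "coeff_sum 0 = 0"
  by (simp add: coeff_sum_def)

lemma coeff_sum_frag_of [simp]: "coeff_sum (frag_of a) = 1"
  by (simp add: coeff_sum_def)

lemma coeff_sum_diff: "coeff_sum (c - d) = coeff_sum c - coeff_sum d"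
  using coeff_sum_add[of "c - d" d] by simp

lemma simplex_boundary_diff: "simplex_boundary (c - d) = simplex_boundary c - simplex_boundary d"
  by (simp add: simplex_boundary_def frag_extend_diff)

lemma simplex_chains_diff:
  "c \<in> simplex_chains n q \<Longrightarrow> d \<in> simplex_chains n q \<Longrightarrow> c - d \<in> simplex_chains n q"
  unfolding simplex_chains_def using keys_diff[of c d] by blast

section \<open>Cones and the boundary\<close>

definition cone :: "nat \<Rightarrow> (nat list \<Rightarrow>\<^sub>0 int) \<Rightarrow> (nat list \<Rightarrow>\<^sub>0 int)" where
  "cone a = frag_extend (\<lambda>s. frag_of (a # s))"

lemma cone_simps [simp]:
  "cone a 0 = 0" "cone a (frag_of s) = frag_of (a # s)"
  "cone a (c + d) = cone a c + cone a d" "cone a (c - d) = cone a c - cone a d"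
  by (simp_all add: cone_def frag_extend_add frag_extend_diff)

lemma lookup_cone_Cons:
  "Poly_Mapping.lookup (cone a c) (b # t) = (if a = b then Poly_Mapping.lookup c t else 0)"
  by (auto simp: cone_def lookup_frag_extend in_keys_iff if_distrib sum.delta cong: if_cong)

lemma lookup_cone_Nil: "Poly_Mapping.lookup (cone a c) [] = 0"
  by (auto simp: cone_def lookup_frag_extend)

lemma keys_cone: "Poly_Mapping.keys (cone a c) = (#) a ` Poly_Mapping.keys c"
proof (intro set_eqI)
  fix g show "g \<in> Poly_Mapping.keys (cone a c) \<longleftrightarrow> g \<in> (#) a ` Poly_Mapping.keys c"
    by (cases g) (auto simp: in_keys_iff lookup_cone_Cons lookup_cone_Nil)
qed

lemma chain_nonneg_cone: "chain_nonneg c \<Longrightarrow> chain_nonneg (cone a c)"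
  unfolding chain_nonneg_def
  by (metis list.exhaust lookup_cone_Cons lookup_cone_Nil order_refl)

lemma simplex_boundary_Nil [simp]: "simplex_boundary (frag_of []) = 0"
  by (simp add: simplex_boundary_def)

text \<open>Deleting the head gives \<open>s\<close> with sign +1; every other deletion moves one
  place along, which changes its sign. For \<open>s = []\<close> the result is the empty simplex, so
  the augmentation is covered.\<close>

lemma simplex_boundary_Cons:
  "simplex_boundary (frag_of (a # s)) = frag_of s - cone a (simplex_boundary (frag_of s))"
proof -
  have "cone a (simplex_boundary (frag_of s)) =
      (\<Sum>i<length s. frag_cmul ((-1) ^ i) (frag_of (a # take i s @ drop (Suc i) s)))"
    by (simp add: simplex_boundary_def cone_def frag_extend_sum frag_extend_cmul o_def)
  then show ?thesis
    by (simp add: simplex_boundary_def sum.lessThan_Suc_shift sum_negf[symmetric] del: sum.lessThan_Suc)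
qed

text \<open>Prepending \<open>a\<close> is a contracting homotopy, on arbitrary lists since
  \<open>cone\<close> checks no order.\<close>

lemma simplex_boundary_cone: "simplex_boundary (cone a c) = c - cone a (simplex_boundary c)"
  by (rule frag_linear_eqI[of _ UNIV])
    (simp_all add: simplex_boundary_Cons simplex_boundary_diff)

text \<open>In degree 0 the formula for the boundary yields the augmentation, as a multiple of the
  empty simplex.\<close>

lemma simplex_boundary_degree_0:
  assumes "c \<in> simplex_chains n 0"
  shows "simplex_boundary c = frag_cmul (coeff_sum c) (frag_of [])"
proof (rule frag_linear_eqI[where S = "simplex_basis n 0" and f = simplex_boundary])
  show "simplex_boundary (frag_of a) = frag_cmul (coeff_sum (frag_of a)) (frag_of [])"
    if "a \<in> simplex_basis n 0" for a
    using that by (auto simp: simplex_basis_def length_Suc_conv simplex_boundary_Cons)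
qed (use assms in \<open>auto simp: simplex_chains_def simplex_boundary_diff coeff_sum_diff frag_cmul_diff_distrib\<close>)

lemma keys_simplex_boundary:
  "g \<in> Poly_Mapping.keys (simplex_boundary (frag_of a)) \<Longrightarrow>
    sorted_wrt (<) a \<Longrightarrow> Suc (length g) = length a \<and> sorted_wrt (<) g \<and> set g \<subseteq> set a"
proof (induction a arbitrary: g)
  case (Cons a s)
  then show ?case
    using keys_diff[of "frag_of s" "cone a (simplex_boundary (frag_of s))"]
    by (fastforce simp: simplex_boundary_Cons keys_cone)
qed simp

text \<open>The chains \<open>atom s e k\<close> are the entries of the atom generated by \<open>e\<close>, indexed by the length
  \<open>k\<close> of their simplexes (the degree plus one), so that the recursion can start in the augmentation
  degree \<open>k = 0\<close>. There \<open>Plus\<close> is the empty simplex and \<open>Minus\<close> is 0 unless \<open>e\<close> is empty.\<close>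

fun atom :: "sign \<Rightarrow> nat list \<Rightarrow> nat \<Rightarrow> (nat list \<Rightarrow>\<^sub>0 int)" where
  "atom s [] k = (if k = 0 then frag_of [] else 0)"
| "atom Minus (a # e) 0 = 0"
| "atom Plus (a # e) 0 = frag_of []"
| "atom Minus (a # e) (Suc k) = cone a (atom Plus e k)"
| "atom Plus (a # e) (Suc k) = atom Plus e (Suc k) + cone a (atom Minus e k)"

lemma atom_Plus_0 [simp]: "atom Plus e 0 = frag_of []"
  by (cases e) auto

lemma simplex_boundary_atom_0 [simp]: "simplex_boundary (atom s e 0) = 0"
  by (cases e; cases s) auto

text \<open>The boundary of \<open>cone a c\<close> is \<open>c\<close> minus the cone over the
  boundary of \<open>c\<close>. This minus sign is why \<open>atom\<close> exchanges
  \<open>Plus\<close> and \<open>Minus\<close> under \<open>cone a\<close>; both signs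
  \<open>s\<close> then have the same boundary.\<close>

lemma simplex_boundary_atom:
  "simplex_boundary (atom s e (Suc k)) = atom Plus e k - atom Minus e k"
proof (induction e arbitrary: s k)
  case (Cons a e)
  show ?case
    by (cases s; cases k) (simp_all add: simplex_boundary_cone simplex_boundary_add simplex_boundary_Cons Cons.IH)
qed simp

lemma chain_nonneg_frag_of [simp]: "chain_nonneg (frag_of a)"
  by (simp add: chain_nonneg_def)

lemma chain_nonneg_atom: "chain_nonneg (atom s e k)"
  by (induction s e k rule: atom.induct) (auto simp: chain_nonneg_cone chain_nonneg_add)

lemma keys_atom:
  "g \<in> Poly_Mapping.keys (atom s e k) \<Longrightarrow> sorted_wrt (<) e \<Longrightarrow>
    length g = k \<and> sorted_wrt (<) g \<and> set g \<subseteq> set e"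
proof (induction s e k arbitrary: g rule: atom.induct)
  case (5 a e k)
  then show ?case
    using keys_add[of "atom Plus e (Suc k)" "cone a (atom Minus e k)"]
    by (fastforce simp: keys_cone)
next
  case (4 a e k)
  then show ?case by (fastforce simp: keys_cone)
qed (auto split: if_splits)

lemma atom_above: "length e < k \<Longrightarrow> atom s e k = 0"
  by (induction s e k rule: atom.induct) auto

lemma atom_top [simp]: "atom s e (length e) = frag_of e"
  by (induction e arbitrary: s) (case_tac s; simp add: atom_above)+

text \<open>The lexicographic order, reversed after each common entry: removing the entry in an even
  position makes a simplex larger, removing an entry in an odd position makes it smaller.\<close>

function alt_less :: "nat list \<Rightarrow> nat list \<Rightarrow> bool" where
  "alt_less [] t = False"
| "alt_less (a # s) [] = True"
| "alt_less (a # s) (b # t) = (a < b \<or> a = b \<and> alt_less t s)"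
  by pat_completeness auto
termination by (relation "measure (\<lambda>(s, t). length s + length t)") auto

lemma alt_less_irrefl: "\<not> alt_less s s"
  by (induction s) auto

text \<open>Cancelling a common head leaves the tails in reversed order, so the induction measure is
  symmetric in the three lists.\<close>

lemma alt_less_trans: "alt_less s t \<Longrightarrow> alt_less t u \<Longrightarrow> alt_less s u"
proof (induction "length s + length t + length u" arbitrary: s t u rule: less_induct)
  case less
  show ?case
  proof (cases s)
    case (Cons a s')
    with less.prems obtain b t' where t: "t = b # t'" by (cases t) auto
    show ?thesis
    proof (cases u)
      case (Cons c u')
      with less.prems less.hyps[of u' t' s'] show ?thesis
        by (auto simp: t \<open>s = a # s'\<close>)
    qed (simp add: Cons)
  qed (use less.prems in simp)
qed

text \<open>Under \<open>cone a\<close> the sign and the order are reversed together. The other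
  summand of \<open>atom Plus (a # e)\<close> has simplexes starting above \<open>a\<close>, which
  therefore follow \<open>a # e\<close>.\<close>

lemma keys_atom_order:
  "g \<in> Poly_Mapping.keys (atom s e k) \<Longrightarrow> sorted_wrt (<) e \<Longrightarrow>
    g = e \<or> (case s of Plus \<Rightarrow> alt_less e g | Minus \<Rightarrow> alt_less g e)"
proof (induction s e k arbitrary: g rule: atom.induct)
  case (4 a e k)
  then show ?case by (fastforce simp: keys_cone)
next
  case (5 a e k)
  consider "g \<in> Poly_Mapping.keys (atom Plus e (Suc k))" | "g \<in> Poly_Mapping.keys (cone a (atom Minus e k))"
    using 5 keys_add[of "atom Plus e (Suc k)" "cone a (atom Minus e k)"] by auto
  then show ?case
  proof cases
    case 1
    then have "set g \<subseteq> set e" using keys_atom 5 by auto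
    then show ?thesis using 5(4) by (cases g) auto
  next
    case 2
    then show ?thesis using 5 by (fastforce simp: keys_cone)
  qed
qed (auto split: if_splits)

section \<open>Decomposition of cells into atoms\<close>

text \<open>Listing basis elements with multiplicity makes the number of parts available as an
  induction measure.\<close>

lemma nonneg_chain_multiset:
  assumes "chain_nonneg c"
  obtains E where "set_mset E \<subseteq> Poly_Mapping.keys c" "c = (\<Sum>e\<in>#E. frag_of e)"
proof
  let ?E = "\<Sum>a\<in>Poly_Mapping.keys c. replicate_mset (nat (Poly_Mapping.lookup c a)) a"
  have rep: "\<Sum>\<^sub># (replicate_mset k (frag_of a)) = frag_cmul (int k) (frag_of a)" for k and a :: "nat list"
    by (induction k) (simp_all add: frag_cmul_distrib)
  have sm: "(\<Sum>e\<in>#(\<Sum>a\<in>A. N a). frag_of e) = (\<Sum>a\<in>A. \<Sum>e\<in>#N a. frag_of e)"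
    if "finite A" for A and N :: "nat list \<Rightarrow> nat list multiset"
    using that by (induction A rule: finite_induct) auto
  show "set_mset ?E \<subseteq> Poly_Mapping.keys c"
    by (auto simp: set_mset_sum split: if_splits)
  have "(\<Sum>e\<in>#?E. frag_of e) = frag_extend frag_of c"
    using assms by (simp add: sm rep frag_extend_def chain_nonneg_def)
  then show "c = (\<Sum>e\<in>#?E. frag_of e)"
    by (simp flip: frag_expansion)
qed

lemma oriental_morD:
  assumes "x \<in> oriental_mor n"
  shows "x s q \<in> simplex_chains n q" "chain_nonneg (x s q)" "coeff_sum (x s 0) = 1"
    "simplex_boundary (x s (Suc q)) = x Plus q - x Minus q"
  using assms by (auto simp: oriental_mor_def)

lemma oriental_morI:
  assumes "\<And>s q. x s q \<in> simplex_chains n q" "\<And>s q. chain_nonneg (x s q)"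
    "\<And>s. coeff_sum (x s 0) = 1"
    "\<And>s q. simplex_boundary (x s (Suc q)) = x Plus q - x Minus q"
    "\<And>s q. N < q \<Longrightarrow> x s q = 0"
  shows "x \<in> oriental_mor n"
  using assms by (auto simp: oriental_mor_def intro!: exI[of _ N])

text \<open>Shifts from length to degree, leaving out the auxiliary entry of length 0.\<close>

definition atom_cell :: "nat list \<Rightarrow> double_seq" where
  "atom_cell e = (\<lambda>s q. atom s e (Suc q))"

lemma simplex_basis_sorted: "e \<in> simplex_basis n q \<Longrightarrow> sorted_wrt (<) e"
  by (simp add: simplex_basis_def)

lemma atom_in_chains:
  "e \<in> simplex_basis n r \<Longrightarrow> atom s e (Suc q) \<in> simplex_chains n q"
  using keys_atom[of _ s e "Suc q"] by (fastforce simp: simplex_chains_def simplex_basis_def)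

text \<open>In degree 0 the boundary formula yields the augmentation times the empty simplex; for
  nonempty \<open>e\<close> the boundary identity of atoms gives coefficient 1.\<close>

lemma coeff_sum_atom:
  assumes "e \<in> simplex_basis n r"
  shows "coeff_sum (atom s e (Suc 0)) = 1"
proof -
  from assms have "e \<noteq> []" by (auto simp: simplex_basis_def)
  then have "simplex_boundary (atom s e (Suc 0)) = frag_of []"
    by (cases e) (simp_all add: simplex_boundary_atom)
  then show ?thesis
    using simplex_boundary_degree_0[OF atom_in_chains[OF assms, of s 0]]
    by (metis lookup_frag_cmul lookup_frag_of mult.right_neutral)
qed

lemma atom_cell_in_oriental_mor:
  assumes "e \<in> simplex_basis n r"
  shows "atom_cell e \<in> oriental_mor n"
  using assms atom_above[of e]
  by (intro oriental_morI[where N = "length e"])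
    (auto simp: atom_cell_def atom_in_chains chain_nonneg_atom coeff_sum_atom simplex_boundary_atom)

text \<open>No simplex is both an input and an output face of \<open>e\<close>: it would lie on both
  sides of \<open>e\<close> in the order, and its length differs from that of \<open>e\<close>. So
  each coefficient of \<open>c\<close> appears unchanged in one of the two sums.\<close>

lemma chain_nonneg_diff_atom:
  assumes nonneg: "chain_nonneg (c + atom Plus e k)" "chain_nonneg (c + atom Minus e k)"
    and e: "sorted_wrt (<) e" "k < length e"
  shows "chain_nonneg c"
  unfolding chain_nonneg_def
proof
  fix g
  have "g \<notin> Poly_Mapping.keys (atom Plus e k) \<or> g \<notin> Poly_Mapping.keys (atom Minus e k)"
    using keys_atom_order[of g _ e k] keys_atom[of g _ e k] e alt_less_trans alt_less_irrefl
    by fastforce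
  then show "0 \<le> Poly_Mapping.lookup c g"
    using nonneg by (auto simp: chain_nonneg_def lookup_add in_keys_iff dest!: spec[of _ g])
qed

lemma lookup_sum_mset:
  "Poly_Mapping.lookup (\<Sum>e\<in>#E. f e) g = (\<Sum>e\<in>#E. Poly_Mapping.lookup (f e) g)"
  by (induction E) (simp_all add: lookup_add)

text \<open>An \<open>alt_less\<close>-minimal part of a cell can be split off as a left factor, because
  no other part has an output face among its input faces.\<close>

lemma atom_Minus_le:
  assumes x: "x \<in> oriental_mor n"
    and E: "\<And>e'. e' \<in># E \<Longrightarrow> sorted_wrt (<) e' \<and> Suc p < length e'"
    and top: "\<And>s. x s (Suc p) = (\<Sum>e'\<in>#E. atom s e' (Suc (Suc p)))"
    and e: "e \<in># E" "\<And>e'. e' \<in># E \<Longrightarrow> \<not> alt_less e' e"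
  shows "chain_nonneg (x Minus p - atom Minus e (Suc p))"
  unfolding chain_nonneg_def
proof
  fix g
  let ?l = "\<lambda>s e'. Poly_Mapping.lookup (atom s e' (Suc p)) g"
  have l0: "0 \<le> ?l s e'" for s e'
    using chain_nonneg_atom by (auto simp: chain_nonneg_def)
  have x0: "0 \<le> Poly_Mapping.lookup (x s p) g" for s
    using oriental_morD(2)[OF x] by (auto simp: chain_nonneg_def)
  show "0 \<le> Poly_Mapping.lookup (x Minus p - atom Minus e (Suc p)) g"
  proof (cases "g \<in> Poly_Mapping.keys (atom Minus e (Suc p))")
    case True
    have ge: "alt_less g e"
      using keys_atom_order[OF True] keys_atom[OF True] E[OF e(1)] by auto
    \<comment> \<open>An output face \<open>g\<close> of \<open>e'\<close> that is an input face of
      \<open>e\<close> would place \<open>e'\<close> before \<open>g\<close> and \<open>g\<close>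
      before \<open>e\<close>, against the minimality of \<open>e\<close>.\<close>
    have z: "?l Plus e' = 0" if "e' \<in># E" for e'
    proof (rule ccontr)
      assume "?l Plus e' \<noteq> 0"
      then have g': "g \<in> Poly_Mapping.keys (atom Plus e' (Suc p))"
        by (simp add: in_keys_iff)
      have "alt_less e' g"
        using keys_atom_order[OF g'] keys_atom[OF g'] E[OF that] by auto
      with ge e(2)[OF that] alt_less_trans show False by blast
    qed
    have "x Plus p - x Minus p = (\<Sum>e'\<in>#E. atom Plus e' (Suc p) - atom Minus e' (Suc p))"
    proof -
      have "simplex_boundary (\<Sum>e'\<in>#E. atom Plus e' (Suc (Suc p)))
        = (\<Sum>e'\<in>#E. atom Plus e' (Suc p) - atom Minus e' (Suc p))"
        by (induction E) (simp_all add: simplex_boundary_add simplex_boundary_atom)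
      then show ?thesis
        using oriental_morD(4)[OF x, of Plus p] by (simp add: top)
    qed
    then have "Poly_Mapping.lookup (x Plus p - x Minus p) g = (\<Sum>e'\<in>#E. ?l Plus e' - ?l Minus e')"
      by (simp add: lookup_sum_mset lookup_minus)
    also have "\<dots> = (\<Sum>e'\<in>#E. - ?l Minus e')"
      by (intro arg_cong[of _ _ sum_mset] image_mset_cong) (simp add: z)
    also have "\<dots> \<le> - ?l Minus e"
    proof -
      obtain E' where E': "E = add_mset e E'"
        using e(1) by (meson multi_member_split)
      have "(\<Sum>e'\<in>#E'. - ?l Minus e') \<le> 0"
      proof (induction E')
        case (add e' E')
        then show ?case using l0[of Minus e'] by simp
      qed simp
      then show ?thesis by (simp add: E')
    qed
    finally show ?thesis using x0[of Plus] by (simp add: lookup_minus)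
  next
    case False
    then show ?thesis using x0[of Minus] by (simp add: in_keys_iff lookup_minus)
  qed
qed

text \<open>The factors meet in \<open>?w\<close>, the input of \<open>x\<close> with the input
  faces of \<open>e\<close> replaced by its output faces. Minimality of \<open>e\<close> is what
  makes \<open>?w\<close> nonnegative.\<close>

lemma oriental_split:
  assumes x: "x \<in> oriental_mor n"
    and E: "\<And>e'. e' \<in># add_mset e E \<Longrightarrow> e' \<in> simplex_basis n (length e' - 1) \<and> Suc p < length e'"
    and top: "\<And>s q. p < q \<Longrightarrow> x s q = (\<Sum>e'\<in>#add_mset e E. atom s e' (Suc q))"
    and e: "\<And>e'. e' \<in># add_mset e E \<Longrightarrow> \<not> alt_less e' e"
  obtains y z where "y \<in> oriental_mor n" "z \<in> oriental_mor n"
    "oriental_bd Plus p y = oriental_bd Minus p z" "x = oriental_comp p y z"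
    "\<forall>s. \<forall>q>p. y s q = atom s e (Suc q)"
    "\<forall>s. \<forall>q>p. z s q = (\<Sum>e'\<in>#E. atom s e' (Suc q))"
proof -
  let ?w = "x Minus p - atom Minus e (Suc p) + atom Plus e (Suc p)"
  define y :: double_seq where
    "y = (\<lambda>s q. if q < p then x s q
      else if q = p then (case s of Minus \<Rightarrow> x Minus p | Plus \<Rightarrow> ?w) else atom s e (Suc q))"
  define z :: double_seq where
    "z = (\<lambda>s q. if q < p then x s q
      else if q = p then (case s of Minus \<Rightarrow> ?w | Plus \<Rightarrow> x Plus p) else x s q - atom s e (Suc q))"
  note D = oriental_morD[OF x]
  have eb: "e \<in> simplex_basis n (length e - 1)" using E by simp
  \<comment> \<open>This form of the difference shows its nonnegativity above degree
    \<open>p\<close>.\<close>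
  have z_top: "z s q = (\<Sum>e'\<in>#E. atom s e' (Suc q))" if "p < q" for s q
    using that by (simp add: z_def top)
  have w: "chain_nonneg ?w" "?w \<in> simplex_chains n p"
  proof -
    have "chain_nonneg (x Minus p - atom Minus e (Suc p))"
      using E top e by (intro atom_Minus_le[OF x, of "add_mset e E"]) (auto dest: simplex_basis_sorted)
    then show "chain_nonneg ?w" by (intro chain_nonneg_add chain_nonneg_atom)
    show "?w \<in> simplex_chains n p"
      using D atom_in_chains[OF eb] by (intro simplex_chains_add simplex_chains_diff) auto
  qed
  have aug: "coeff_sum ?w = 1" if "p = 0"
    using that coeff_sum_atom[OF eb] D(3) by (simp add: coeff_sum_add coeff_sum_diff)
  have bd_w: "simplex_boundary ?w = simplex_boundary (x Minus p)"
    by (simp add: simplex_boundary_add simplex_boundary_diff simplex_boundary_atom)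
  obtain N where N: "\<And>s q. N < q \<Longrightarrow> x s q = 0"
    using x by (auto simp: oriental_mor_def)
  have nonneg_z: "chain_nonneg (\<Sum>e'\<in>#E. atom s e' (Suc q))" for s q
    by (induction E) (auto simp: chain_nonneg_add chain_nonneg_atom)
  have y: "y \<in> oriental_mor n"
  proof (rule oriental_morI[where N = "max p (length e)"])
    fix s q
    show "y s q \<in> simplex_chains n q"
      using D w atom_in_chains[OF eb] by (auto simp: y_def split: sign.split)
    show "chain_nonneg (y s q)"
      using D w by (auto simp: y_def chain_nonneg_atom split: sign.split)
    show "coeff_sum (y s 0) = 1"
      using D aug by (auto simp: y_def split: sign.split)
    show "simplex_boundary (y s (Suc q)) = y Plus q - y Minus q"
    proof -
      consider "Suc q < p" | "Suc q = p" | "q = p" | "p < q" by linarith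
      then show ?thesis
        by cases (use D(4)[of _ q] bd_w in
          \<open>auto simp: y_def simplex_boundary_atom split: sign.split\<close>)
    qed
    show "y s q = 0" if "max p (length e) < q"
      using that by (auto simp: y_def intro!: atom_above)
  qed
  have z: "z \<in> oriental_mor n"
  proof (rule oriental_morI[where N = "max (max p (length e)) N"])
    fix s q
    show "z s q \<in> simplex_chains n q"
      using D w atom_in_chains[OF eb] by (auto simp: z_def intro!: simplex_chains_diff split: sign.split)
    show "chain_nonneg (z s q)"
      using D w nonneg_z[of s q] z_top[of q s] by (auto simp: z_def split: sign.split)
    show "coeff_sum (z s 0) = 1"
      using D aug coeff_sum_atom[OF eb]  by (auto simp: z_def split: sign.split)
    show "simplex_boundary (z s (Suc q)) = z Plus q - z Minus q"
    proof -
      consider "Suc q < p" | "Suc q = p" | "q = p" | "p < q" by linarith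
      then show ?thesis
        by cases (use D(4)[of _ q] bd_w in
          \<open>auto simp: z_def simplex_boundary_atom simplex_boundary_diff split: sign.split\<close>)
    qed
    show "z s q = 0" if "max (max p (length e)) N < q"
      using that by (auto simp: z_def N intro!: atom_above)
  qed
  have c: "oriental_bd Plus p y = oriental_bd Minus p z"
    by (auto simp: oriental_composable_iff y_def z_def)
  have "x = oriental_comp p y z"
    unfolding fun_eq_iff oriental_comp_apply[OF c] by (auto simp: y_def z_def split: sign.split)
  then show ?thesis
    using that[OF y z c] z_top by (simp add: y_def)
qed

text \<open>The cell \<open>x\<close> has the same entries in degrees \<open>\<ge> p\<close> as a formal sum of atoms. While
  there are several atoms they are split off one by one; a single atom leaves a nonnegative
  remainder in degree \<open>p - 1\<close>, which contributes further atoms to the formal sum.\<close>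

lemma oriental_generation_aux:
  assumes atoms: "\<And>e. e \<in> simplex_basis n (length e - 1) \<Longrightarrow> length e \<le> Suc d \<Longrightarrow> P (atom_cell e)"
    and comp: "\<And>p y z. \<lbrakk>y \<in> oriental_mor n; z \<in> oriental_mor n;
      oriental_bd Plus p y = oriental_bd Minus p z; P y; P z\<rbrakk> \<Longrightarrow> P (oriental_comp p y z)"
  shows "\<lbrakk>x \<in> oriental_mor n; p \<le> d;
      \<And>e. e \<in># E \<Longrightarrow> e \<in> simplex_basis n (length e - 1) \<and> p < length e \<and> length e \<le> Suc d;
      \<And>s q. p \<le> q \<Longrightarrow> x s q = (\<Sum>e\<in>#E. atom s e (Suc q))\<rbrakk> \<Longrightarrow> P x"
proof (induction p arbitrary: x E)
  case 0
  \<comment> \<open>Each atom has augmentation 1, as has \<open>x\<close>, so exactly one atom is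
    left.\<close>
  have "coeff_sum (x Plus 0) = int (size E)"
    unfolding 0(4)[OF order_refl] using 0(3)
  proof (induction E)
    case (add e E)
    then have "e \<in> simplex_basis n (length e - 1)" by simp
    from coeff_sum_atom[OF this] add show ?case by (simp add: coeff_sum_add)
  qed simp
  with oriental_morD(3)[OF 0(1)] have "size E = 1" by simp
  then obtain e where "E = {#e#}" using size_1_singleton_mset by blast
  with 0 have "x = atom_cell e" "e \<in> simplex_basis n (length e - 1)" "length e \<le> Suc d"
    by (auto simp: atom_cell_def fun_eq_iff)
  with atoms show ?case by blast
next
  case (Suc p)
  show ?case
    using Suc.prems
  proof (induction "size E" arbitrary: x E rule: less_induct)
    case less
    note D = oriental_morD[OF less.prems(1)]
    show ?case
    proof (cases "size E \<le> 1")
      case True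
      \<comment> \<open>The part of degree \<open>p\<close> not accounted for by \<open>E\<close>.
        The boundary condition makes it independent of the sign, so one multiset of simplexes serves
        both signs.\<close>
      define c where "c = x Plus p - (\<Sum>e\<in>#E. atom Plus e (Suc p))"
      have "simplex_boundary (x Plus (Suc p)) = (\<Sum>e\<in>#E. atom Plus e (Suc p) - atom Minus e (Suc p))"
        unfolding less.prems(4)[OF order_refl]
        by (induction E) (simp_all add: simplex_boundary_add simplex_boundary_atom)
      moreover have diff: "(\<Sum>e\<in>#E. atom Plus e (Suc p) - atom Minus e (Suc p)) =
          (\<Sum>e\<in>#E. atom Plus e (Suc p)) - (\<Sum>e\<in>#E. atom Minus e (Suc p))"
        by (induction E) simp_all
      ultimately have c': "c = x Minus p - (\<Sum>e\<in>#E. atom Minus e (Suc p))"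
        unfolding c_def by (simp add: D(4) diff algebra_simps)
      have xp: "x s p = c + (\<Sum>e\<in>#E. atom s e (Suc p))" for s
        by (cases s) (simp_all add: c', simp add: c'[symmetric] c_def)
      have keys_c: "Poly_Mapping.keys c \<subseteq> simplex_basis n p"
      proof -
        have "(\<Sum>e\<in>#E. atom Plus e (Suc p)) \<in> simplex_chains n p"
          using less.prems(3)
        proof (induction E)
          case (add e E)
          then have "e \<in> simplex_basis n (length e - 1)" by simp
          then have "atom Plus e (Suc p) \<in> simplex_chains n p" by (rule atom_in_chains)
          moreover have "(\<Sum>e\<in>#E. atom Plus e (Suc p)) \<in> simplex_chains n p"
            using add by simp
          ultimately show ?case using simplex_chains_add by simp
        qed simp
        then have "c \<in> simplex_chains n p"
          unfolding c_def using D by (intro simplex_chains_diff)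
        then show ?thesis by (simp add: simplex_chains_def)
      qed
      have "chain_nonneg c"
      proof (cases "E = {#}")
        case True
        then show ?thesis using D(2)[of Plus p] by (simp add: c_def)
      next
        case False
        with True have "size E = 1" by (simp add: le_Suc_eq)
        then obtain e where e: "E = {#e#}" using size_1_singleton_mset by blast
        show ?thesis
          using D(2)[of Plus p] D(2)[of Minus p] less.prems(3)[of e]
          by (intro chain_nonneg_diff_atom[of c e "Suc p"]) (auto simp: e xp dest: simplex_basis_sorted)
      qed
      then obtain C where C: "set_mset C \<subseteq> Poly_Mapping.keys c" "c = (\<Sum>e\<in>#C. frag_of e)"
        by (rule nonneg_chain_multiset)
      have len_C: "e \<in> simplex_basis n p \<and> length e = Suc p" if "e \<in># C" for e
        using that C keys_c by (auto simp: simplex_basis_def)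
      \<comment> \<open>The atom of a simplex of \<open>C\<close> contributes this simplex in degree
        \<open>p\<close> and nothing above.\<close>
      show ?thesis
      proof (rule Suc.IH[where E = "E + C"])
        show "x \<in> oriental_mor n" "p \<le> d" using less.prems by auto
        show "e \<in> simplex_basis n (length e - 1) \<and> p < length e \<and> length e \<le> Suc d" if "e \<in># E + C" for e
          using that less.prems(2) less.prems(3)[of e] len_C[of e] by auto
        fix s q assume "p \<le> q"
        show "x s q = (\<Sum>e\<in>#E + C. atom s e (Suc q))"
        proof (cases "q = p")
          case True
          have "(\<Sum>e\<in>#C. atom s e (Suc p)) = (\<Sum>e\<in>#C. frag_of e)"
            by (intro arg_cong[of _ _ sum_mset] image_mset_cong) (metis atom_top len_C)
          then show ?thesis using True by (simp add: xp C(2)[symmetric])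
        next
          case False
          have "(\<Sum>e\<in>#C. atom s e (Suc q)) = (\<Sum>e\<in>#C. 0)"
            using len_C False \<open>p \<le> q\<close> by (intro arg_cong[of _ _ sum_mset] image_mset_cong atom_above) auto
          then show ?thesis using False \<open>p \<le> q\<close> less.prems(4)[of q s] by simp
        qed
      qed
    next
      case False
      then have ne: "set_mset E \<noteq> {}" by auto
      obtain e where e: "e \<in># E" "\<And>e'. e' \<in># E \<Longrightarrow> \<not> alt_less e' e"
      proof -
        have "\<exists>m\<in>set_mset E. \<forall>x\<in>set_mset E. x \<noteq> m \<longrightarrow> \<not> alt_less x m"
        proof (rule Finite_Set.bex_min_element[OF _ _ _ ne])
          show "asymp_on (set_mset E) alt_less"
            using alt_less_trans alt_less_irrefl by (intro asymp_onI) blast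
          show "transp_on (set_mset E) alt_less"
            using alt_less_trans by (intro transp_onI) blast
        qed simp
        then obtain m where "m \<in># E" "\<And>e'. e' \<in># E \<Longrightarrow> e' \<noteq> m \<Longrightarrow> \<not> alt_less e' m" by auto
        then show ?thesis using that[of m] alt_less_irrefl[of m] by metis
      qed
      then obtain E' where E': "E = add_mset e E'" by (meson multi_member_split)
      have "size E = Suc (size E')" by (simp add: E')
      \<comment> \<open>There are at least two atoms, so both factors have fewer than
        \<open>x\<close>.\<close>
      with False have sz: "size {#e#} < size E" "size E' < size E" by (simp_all add: nonempty_has_size)
      have parts: "e' \<in> simplex_basis n (length e' - 1) \<and> Suc p < length e'"
        if "e' \<in># add_mset e E'" for e'
        using less.prems(3)[of e'] that by (simp add: E')
      have top: "x s q = (\<Sum>e'\<in>#add_mset e E'. atom s e' (Suc q))" if "p < q" for s q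
        using less.prems(4)[of q s] that by (simp add: E')
      obtain y z where yz: "y \<in> oriental_mor n" "z \<in> oriental_mor n"
        "oriental_bd Plus p y = oriental_bd Minus p z" "x = oriental_comp p y z"
        "\<forall>s. \<forall>q>p. y s q = atom s e (Suc q)"
        "\<forall>s. \<forall>q>p. z s q = (\<Sum>e'\<in>#E'. atom s e' (Suc q))"
        by (rule oriental_split[OF less.prems(1) parts top e(2)[unfolded E']])
      have "P y"
      proof (rule less.hyps[OF sz(1) yz(1) less.prems(2)])
        show "e' \<in> simplex_basis n (length e' - 1) \<and> Suc p < length e' \<and> length e' \<le> Suc d"
          if "e' \<in># {#e#}" for e'
          using less.prems(3)[OF e(1)] that by simp
        show "y s q = (\<Sum>e'\<in>#{#e#}. atom s e' (Suc q))" if "Suc p \<le> q" for s q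
          using yz(5) that by simp
      qed
      moreover have "P z"
      proof (rule less.hyps[OF sz(2) yz(2) less.prems(2)])
        show "e' \<in> simplex_basis n (length e' - 1) \<and> Suc p < length e' \<and> length e' \<le> Suc d"
          if "e' \<in># E'" for e'
          using less.prems(3)[of e'] that by (simp add: E')
        show "z s q = (\<Sum>e'\<in>#E'. atom s e' (Suc q))" if "Suc p \<le> q" for s q
          using yz(6) that by simp
      qed
      ultimately show ?thesis unfolding yz(4) by (rule comp[OF yz(1-3)])
    qed
  qed
qed

text \<open>In degree \<open>d\<close> both entries of \<open>x\<close> are the same sum of
  \<open>d\<close>-simplexes, which is the initial formal sum of atoms. The bound on
  \<open>length e\<close> supports induction on the dimension.\<close>

lemma oriental_generation:
  assumes "x \<in> oriental_mor n" "\<And>s q. d < q \<Longrightarrow> x s q = 0"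
    and atoms: "\<And>e. e \<in> simplex_basis n (length e - 1) \<Longrightarrow> length e \<le> Suc d \<Longrightarrow> P (atom_cell e)"
    and comp: "\<And>p y z. \<lbrakk>y \<in> oriental_mor n; z \<in> oriental_mor n;
      oriental_bd Plus p y = oriental_bd Minus p z; P y; P z\<rbrakk> \<Longrightarrow> P (oriental_comp p y z)"
  shows "P x"
proof -
  note D = oriental_morD[OF assms(1)]
  obtain C where C: "set_mset C \<subseteq> Poly_Mapping.keys (x Plus d)" "x Plus d = (\<Sum>e\<in>#C. frag_of e)"
    using D(2) by (rule nonneg_chain_multiset)
  have xd: "x s d = x Plus d" for s
    using D(4)[of Plus d] assms(2)[of "Suc d"] by (cases s) auto
  have len_C: "e \<in> simplex_basis n d \<and> length e = Suc d" if "e \<in># C" for e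
    using that C D(1)[of Plus d] by (auto simp: simplex_basis_def simplex_chains_def)
  show ?thesis
  proof (rule oriental_generation_aux[where d = d and p = d and E = C and P = P, OF atoms comp assms(1)])
    show "e \<in> simplex_basis n (length e - 1) \<and> d < length e \<and> length e \<le> Suc d" if "e \<in># C" for e
      using len_C[OF that] by auto
    fix s q assume "d \<le> q"
    show "x s q = (\<Sum>e\<in>#C. atom s e (Suc q))"
    proof (cases "q = d")
      case True
      have "(\<Sum>e\<in>#C. atom s e (Suc d)) = (\<Sum>e\<in>#C. frag_of e)"
        by (intro arg_cong[of _ _ sum_mset] image_mset_cong) (metis atom_top len_C)
      then show ?thesis using True by (simp add: xd[of s] C(2)[symmetric])
    next
      case False
      have "(\<Sum>e\<in>#C. atom s e (Suc q)) = (\<Sum>e\<in>#C. 0)"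
        using len_C False \<open>d \<le> q\<close> by (intro arg_cong[of _ _ sum_mset] image_mset_cong atom_above) auto
      then show ?thesis using False \<open>d \<le> q\<close> assms(2)[of q s] by simp
    qed
  qed auto
qed

section \<open>The action of the linearised simplex category on chains\<close>

lemma zdelta_act_linear:
  "zdelta_act x c = frag_extend (\<lambda>a. frag_extend (\<lambda>f. delta_act_basis f a) x) c"
  unfolding zdelta_act_def by (rule frag_extend_swap)

lemma zdelta_act_simps [simp]:
  "zdelta_act x 0 = 0"
  "zdelta_act x (c + d) = zdelta_act x c + zdelta_act x d"
  "zdelta_act x (c - d) = zdelta_act x c - zdelta_act x d"
  "zdelta_act 0 c = 0"
  "zdelta_act (x + y) c = zdelta_act x c + zdelta_act y c"
  "zdelta_act (x - y) c = zdelta_act x c - zdelta_act y c"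
  "zdelta_act (frag_cmul k x) c = frag_cmul k (zdelta_act x c)"
  "zdelta_act (frag_of f) (frag_of a) = delta_act_basis f a"
proof -
  show "zdelta_act x 0 = 0" "zdelta_act x (c + d) = zdelta_act x c + zdelta_act x d"
    "zdelta_act x (c - d) = zdelta_act x c - zdelta_act x d"
    unfolding zdelta_act_linear by (simp_all add: frag_extend_add frag_extend_diff)
qed (simp_all add: zdelta_act_def frag_extend_add frag_extend_diff frag_extend_cmul)

lemma zdelta_act_frag_of: "zdelta_act (frag_of f) c = frag_extend (delta_act_basis f) c"
  by (simp add: zdelta_act_def)

lemma zdelta_act_basis: "zdelta_act x (frag_of a) = frag_extend (\<lambda>f. delta_act_basis f a) x"
  by (simp add: zdelta_act_def)

lemma zdelta_act_extend: "zdelta_act x c = frag_extend (\<lambda>a. zdelta_act x (frag_of a)) c"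
  unfolding zdelta_act_basis by (rule zdelta_act_linear)

lemma chain_nonneg_frag_extend:
  assumes "chain_nonneg c" "\<And>a. a \<in> Poly_Mapping.keys c \<Longrightarrow> chain_nonneg (b a)"
  shows "chain_nonneg (frag_extend b c)"
  using assms unfolding chain_nonneg_def lookup_frag_extend by (intro allI sum_nonneg mult_nonneg_nonneg) auto

lemma frag_extend_in_simplex_chains:
  assumes "\<And>a. a \<in> Poly_Mapping.keys c \<Longrightarrow> b a \<in> simplex_chains n q"
  shows "frag_extend b c \<in> simplex_chains n q"
  using assms keys_frag_extend[of b c] by (fastforce simp: simplex_chains_def)

lemma delta_nth_le: "f \<in> Delta m n \<Longrightarrow> i \<le> m \<Longrightarrow> f ! i \<le> n"
  unfolding Delta_def using nth_mem[of i f] by fastforce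

lemma delta_act_basis_in_chains:
  assumes "f \<in> Delta m n" "a \<in> simplex_basis m q"
  shows "delta_act_basis f a \<in> simplex_chains n q"
  using assms delta_nth_le[OF assms(1)]
  by (auto simp: delta_act_basis_def simplex_chains_def simplex_basis_def)

lemma zdelta_act_in_chains:
  assumes "x \<in> ZDelta m n" "c \<in> simplex_chains m q"
  shows "zdelta_act x c \<in> simplex_chains n q"
  unfolding zdelta_act_def using assms
  by (intro frag_extend_in_simplex_chains delta_act_basis_in_chains)
    (auto simp: ZDelta_def simplex_chains_def)

lemma coeff_sum_frag_extend:
  assumes "\<And>a. a \<in> Poly_Mapping.keys c \<Longrightarrow> coeff_sum (b a) = k"
  shows "coeff_sum (frag_extend b c) = coeff_sum c * k"
  by (rule frag_linear_eqI[where S = "Poly_Mapping.keys c" and c = c])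
    (use assms in \<open>auto simp: coeff_sum_diff frag_extend_diff left_diff_distrib\<close>)

text \<open>A monotone map sends a vertex to a vertex, never to 0, and so preserves the
  augmentation.\<close>

lemma coeff_sum_zdelta_act:
  assumes "c \<in> simplex_chains m 0"
  shows "coeff_sum (zdelta_act x c) = coeff_sum x * coeff_sum c"
  unfolding zdelta_act_def
proof (rule coeff_sum_frag_extend)
  fix f
  have "coeff_sum (frag_extend (delta_act_basis f) c) = coeff_sum c * 1"
    using assms by (intro coeff_sum_frag_extend)
      (auto simp: simplex_chains_def simplex_basis_def delta_act_basis_def length_Suc_conv)
  then show "coeff_sum (frag_extend (delta_act_basis f) c) = coeff_sum c" by simp
qed

section \<open>Degenerate tuples and the chain map property\<close>

definition strict_part :: "nat list \<Rightarrow> (nat list \<Rightarrow>\<^sub>0 int)" where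
  "strict_part l = (if sorted_wrt (<) l then frag_of l else 0)"

definition strict_cone :: "nat \<Rightarrow> (nat list \<Rightarrow>\<^sub>0 int) \<Rightarrow> (nat list \<Rightarrow>\<^sub>0 int)" where
  "strict_cone a = frag_extend (\<lambda>s. if \<forall>b\<in>set s. a < b then frag_of (a # s) else 0)"

text \<open>Discarding weakly increasing tuples with repetitions respects the boundary: if the first
  two entries are equal, deleting either gives cancelling terms, and all other faces contain both.
  This reduces \<open>delta_act_basis\<close> to entrywise mapping.\<close>

lemma simplex_boundary_strict_part:
  assumes "sorted l"
  shows "frag_extend strict_part (simplex_boundary (frag_of l)) = simplex_boundary (strict_part l)"
  using assms
proof (induction l)
  case (Cons a s)
  have strict_Cons: "strict_part (a # t) = strict_cone a (strict_part t)" for t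
    by (auto simp: strict_part_def strict_cone_def)
  have diff: "strict_cone a (c - d) = strict_cone a c - strict_cone a d" for c d
    by (simp add: strict_cone_def frag_extend_diff)
  have cone: "frag_extend strict_part (cone a c) = strict_cone a (frag_extend strict_part c)" for c
    by (rule frag_linear_eqI[of _ UNIV]) (simp_all add: strict_Cons frag_extend_diff diff)
  have "frag_extend strict_part (simplex_boundary (frag_of (a # s))) =
      strict_part s - strict_cone a (simplex_boundary (strict_part s))"
    using Cons by (simp add: simplex_boundary_Cons frag_extend_diff cone)
  also have "\<dots> = simplex_boundary (strict_part (a # s))"
  proof (cases "sorted_wrt (<) s")
    case True
    have above: "strict_cone a c = cone a c"
      if "\<And>g. g \<in> Poly_Mapping.keys c \<Longrightarrow> \<forall>b\<in>set g. a < b" for c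
      unfolding strict_cone_def cone_def using that by (intro frag_extend_eq) auto
    show ?thesis
    proof (cases "\<forall>b\<in>set s. a < b")
      case less: True
      have "strict_cone a (simplex_boundary (frag_of s)) = cone a (simplex_boundary (frag_of s))"
        using keys_simplex_boundary[OF _ True] less by (intro above) blast
      with True less show ?thesis by (simp add: strict_part_def simplex_boundary_Cons)
    next
      case False
      \<comment> \<open>\<open>a\<close> is weakly but not strictly below \<open>s\<close>, so it
        equals the head of \<open>s\<close>.\<close>
      with Cons.prems True obtain t where s: "s = a # t"
        by (cases s) (auto simp: le_less)
      have "strict_cone a (simplex_boundary (frag_of s)) = strict_cone a (frag_of t) - strict_cone a (cone a (simplex_boundary (frag_of t)))"
        by (simp add: s simplex_boundary_Cons diff)
      also have "strict_cone a (cone a (simplex_boundary (frag_of t))) = 0"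
        unfolding strict_cone_def[of a] by (rule frag_extend_eq_0) (auto simp: keys_cone)
      also have "strict_cone a (frag_of t) = frag_of s"
        using True by (simp add: s strict_cone_def)
      finally show ?thesis using True by (simp add: strict_part_def s)
    qed
  qed (simp add: strict_part_def strict_cone_def)
  finally show ?case .
qed (simp add: strict_part_def)

lemma simplex_boundary_map:
  "simplex_boundary (frag_of (map h a)) = frag_extend (\<lambda>s. frag_of (map h s)) (simplex_boundary (frag_of a))"
  by (simp add: simplex_boundary_def frag_extend_sum frag_extend_cmul o_def take_map drop_map)

lemma delta_act_basis_strict_part: "delta_act_basis f a = strict_part (map (\<lambda>i. f ! i) a)"
  by (simp add: delta_act_basis_def strict_part_def)

lemma sorted_map_delta:
  assumes "f \<in> Delta m n" "sorted a" "set a \<subseteq> {0..m}"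
  shows "sorted (map (\<lambda>i. f ! i) a)"
  using assms unfolding Delta_def
  by (intro sorted_wrt_mono_rel[of a "(\<le>)", THEN sorted_wrt_map[THEN iffD2]])
    (auto simp: sorted_nth_mono subset_iff)

lemma zdelta_act_boundary:
  assumes x: "x \<in> ZDelta m n" and c: "c \<in> simplex_chains m q"
  shows "zdelta_act x (simplex_boundary c) = simplex_boundary (zdelta_act x c)"
proof -
  have "frag_extend (delta_act_basis f) (simplex_boundary c) = simplex_boundary (frag_extend (delta_act_basis f) c)"
    if f: "f \<in> Delta m n" for f
  proof (rule frag_linear_eqI[where S = "simplex_basis m q" and
        f = "\<lambda>c. frag_extend (delta_act_basis f) (simplex_boundary c)"])
    fix a assume a: "a \<in> simplex_basis m q"
    have "sorted (map (\<lambda>i. f ! i) a)"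
      using a f by (intro sorted_map_delta) (auto simp: simplex_basis_def strict_sorted_imp_sorted)
    from simplex_boundary_strict_part[OF this]
    show "frag_extend (delta_act_basis f) (simplex_boundary (frag_of a)) =
        simplex_boundary (frag_extend (delta_act_basis f) (frag_of a))"
      unfolding simplex_boundary_map
      by (simp add: delta_act_basis_strict_part[abs_def] frag_extend_compose[unfolded o_def])
  qed (use c in \<open>auto simp: simplex_chains_def simplex_boundary_diff frag_extend_diff\<close>)
  then have basis: "zdelta_act (frag_of f) (simplex_boundary c) = simplex_boundary (zdelta_act (frag_of f) c)"
    if "f \<in> Delta m n" for f
    using that by (simp add: zdelta_act_frag_of)
  show ?thesis
    by (rule frag_linear_eqI[where S = "Delta m n" and f = "\<lambda>x. zdelta_act x (simplex_boundary c)"])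
      (use x basis in \<open>auto simp: ZDelta_def simplex_boundary_diff\<close>)
qed

text \<open>If the composite is injective on the vertices of \<open>a\<close>, so is
  \<open>f\<close>; hence a simplex annihilated by \<open>f\<close> is annihilated by the
  composite.\<close>

lemma delta_act_basis_comp:
  assumes g: "g \<in> Delta m n" and f: "f \<in> Delta l m" and a: "a \<in> simplex_basis l q"
  shows "delta_act_basis (delta_comp g f) a = frag_extend (delta_act_basis g) (delta_act_basis f a)"
proof -
  have len: "i < length f" if "i \<in> set a" for i
    using that a f by (auto simp: simplex_basis_def Delta_def)
  then have comp: "map (\<lambda>i. delta_comp g f ! i) a = map (\<lambda>i. g ! i) (map (\<lambda>i. f ! i) a)"
    by (auto simp: delta_comp_def)
  have "sorted_wrt (<) (map (\<lambda>i. f ! i) a)" if "sorted_wrt (<) (map (\<lambda>i. delta_comp g f ! i) a)"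
  proof -
    have "sorted (map (\<lambda>i. f ! i) a)"
      using a f by (intro sorted_map_delta) (auto simp: simplex_basis_def strict_sorted_imp_sorted)
    moreover have "distinct (map (\<lambda>i. f ! i) a)"
      using that unfolding comp strict_sorted_iff by (auto simp: distinct_map intro: inj_on_imageI2)
    ultimately show ?thesis by (simp add: strict_sorted_iff)
  qed
  then show ?thesis
    unfolding delta_act_basis_def comp by auto
qed

section \<open>Composition and functoriality of the action\<close>

lemma zdelta_comp_closed:
  assumes "x \<in> ZDelta m n" "y \<in> ZDelta l m"
  shows "zdelta_comp x y \<in> ZDelta l n"
proof -
  have "f \<in> Delta l n" if f: "f \<in> Poly_Mapping.keys (zdelta_comp x y)" for f
  proof -
    obtain g where g: "g \<in> Poly_Mapping.keys x"
      "f \<in> Poly_Mapping.keys (frag_extend (\<lambda>f. frag_of (delta_comp g f)) y)"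
      using subsetD[OF keys_frag_extend f[unfolded zdelta_comp_def]] by blast
    then obtain h where "h \<in> Poly_Mapping.keys y" "f = delta_comp g h"
      using keys_frag_extend[of "\<lambda>f. frag_of (delta_comp g f)" y] by auto
    with g assms show ?thesis using delta_comp_closed[of g m n h l] by (auto simp: ZDelta_def)
  qed
  then show ?thesis by (auto simp: ZDelta_def)
qed

lemma coeff_sum_zdelta_comp: "coeff_sum (zdelta_comp x y) = coeff_sum x * coeff_sum y"
  unfolding zdelta_comp_def
  by (intro coeff_sum_frag_extend) (simp add: coeff_sum_frag_extend[where k = 1])

lemma frag_extend_fun_diff:
  "frag_extend (\<lambda>a. f a - g a) c = frag_extend f c - frag_extend g c"
  by (rule frag_linear_eqI[where S = UNIV and f = "frag_extend (\<lambda>a. f a - g a)"])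
    (simp_all add: frag_extend_diff)

lemma zdelta_comp_diff:
  "zdelta_comp (x - x') y = zdelta_comp x y - zdelta_comp x' y"
  "zdelta_comp x (y - y') = zdelta_comp x y - zdelta_comp x y'"
  unfolding zdelta_comp_def by (simp_all add: frag_extend_diff frag_extend_fun_diff)

lemma zdelta_act_comp:
  assumes x: "x \<in> ZDelta m n" and y: "y \<in> ZDelta l m" and c: "c \<in> simplex_chains l q"
  shows "zdelta_act (zdelta_comp x y) c = zdelta_act x (zdelta_act y c)"
proof (rule frag_linear_eqI[where S = "simplex_basis l q" and f = "zdelta_act (zdelta_comp x y)"])
  fix a assume a: "a \<in> simplex_basis l q"
  show "zdelta_act (zdelta_comp x y) (frag_of a) = zdelta_act x (zdelta_act y (frag_of a))"
  proof (rule frag_linear_eqI[where S = "Delta m n" and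
        f = "\<lambda>x. zdelta_act (zdelta_comp x y) (frag_of a)"])
    fix g assume g: "g \<in> Delta m n"
    show "zdelta_act (zdelta_comp (frag_of g) y) (frag_of a) = zdelta_act (frag_of g) (zdelta_act y (frag_of a))"
    proof (rule frag_linear_eqI[where S = "Delta l m" and
          f = "\<lambda>y. zdelta_act (zdelta_comp (frag_of g) y) (frag_of a)"])
      fix f assume f: "f \<in> Delta l m"
      show "zdelta_act (zdelta_comp (frag_of g) (frag_of f)) (frag_of a) =
          zdelta_act (frag_of g) (zdelta_act (frag_of f) (frag_of a))"
        using delta_act_basis_comp[OF g f a] by (simp add: zdelta_comp_def zdelta_act_frag_of)
    qed (use y in \<open>auto simp: ZDelta_def zdelta_comp_diff\<close>)
  qed (use x in \<open>auto simp: ZDelta_def zdelta_comp_diff\<close>)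
qed (use c in \<open>auto simp: simplex_chains_def\<close>)

text \<open>Condition (2) says that the induced chain map is nonnegative: injective morphisms in
  \<open>\<Delta>\<close> with codomain \<open>m\<close> are the basis elements of \<open>K[m]\<close>.\<close>

lemma lookup_zdelta_act:
  assumes "sorted_wrt (<) g"
  shows "Poly_Mapping.lookup (zdelta_act x (frag_of a)) g =
    (\<Sum>f\<in>Poly_Mapping.keys x. Poly_Mapping.lookup x f * (if map (\<lambda>i. f ! i) a = g then 1 else 0))"
  unfolding zdelta_act_basis lookup_frag_extend
  using assms by (intro sum.cong) (auto simp: delta_act_basis_def)

lemma lookup_zdelta_comp:
  "Poly_Mapping.lookup (zdelta_comp x (frag_of a)) g =
    (\<Sum>f\<in>Poly_Mapping.keys x. Poly_Mapping.lookup x f * (if map (\<lambda>i. f ! i) a = g then 1 else 0))"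
  unfolding zdelta_comp_def lookup_frag_extend
  by (intro sum.cong) (auto simp: delta_comp_def)

lemma injective_Delta: "f \<in> Delta l m \<and> distinct f \<longleftrightarrow> f \<in> simplex_basis m l"
  by (auto simp: Delta_def simplex_basis_def strict_sorted_iff)

text \<open>\<open>zdelta_comp\<close> keeps noninjective composites and \<open>zdelta_act\<close>
  drops them, but at a strictly increasing \<open>g\<close> both coefficients sum over the maps
  carrying \<open>a\<close> to \<open>g\<close>.\<close>

lemma oriental_coeffs_iff:
  "x \<in> oriental_coeffs m n \<longleftrightarrow> x \<in> ZDelta m n \<and> coeff_sum x = 1 \<and>
    (\<forall>l. \<forall>a\<in>simplex_basis m l. chain_nonneg (zdelta_act x (frag_of a)))"
proof -
  have "(\<forall>g\<in>simplex_basis n l. 0 \<le> Poly_Mapping.lookup (zdelta_comp x (frag_of a)) g) \<longleftrightarrow>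
      chain_nonneg (zdelta_act x (frag_of a))"
    if x: "x \<in> ZDelta m n" and a: "a \<in> simplex_basis m l" for l a
  proof -
    have "Poly_Mapping.lookup (zdelta_comp x (frag_of a)) g = Poly_Mapping.lookup (zdelta_act x (frag_of a)) g"
      if "g \<in> simplex_basis n l" for g
      using that by (simp add: lookup_zdelta_comp lookup_zdelta_act simplex_basis_def)
    moreover have "Poly_Mapping.lookup (zdelta_act x (frag_of a)) g = 0" if "g \<notin> simplex_basis n l" for g
      using zdelta_act_in_chains[OF x, of "frag_of a" l] a that
      by (auto simp: simplex_chains_def in_keys_iff)
    ultimately show ?thesis by (auto simp: chain_nonneg_def)
  qed
  then show ?thesis
    unfolding oriental_coeffs_def using injective_Delta by blast
qed

lemma chain_nonneg_zdelta_act: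
  assumes "x \<in> oriental_coeffs m n" "c \<in> simplex_chains m q" "chain_nonneg c"
  shows "chain_nonneg (zdelta_act x c)"
  unfolding zdelta_act_extend[of x c]
  using assms by (intro chain_nonneg_frag_extend) (auto simp: oriental_coeffs_iff simplex_chains_def)

lemma zdelta_comp_in_oriental_coeffs:
  assumes x: "x \<in> oriental_coeffs m n" and y: "y \<in> oriental_coeffs l m"
  shows "zdelta_comp x y \<in> oriental_coeffs l n"
  unfolding oriental_coeffs_iff
proof (intro conjI allI ballI)
  have xy: "x \<in> ZDelta m n" "y \<in> ZDelta l m" using x y by (auto simp: oriental_coeffs_iff)
  then show "zdelta_comp x y \<in> ZDelta l n" by (rule zdelta_comp_closed)
  show "coeff_sum (zdelta_comp x y) = 1"
    using x y by (simp add: coeff_sum_zdelta_comp oriental_coeffs_iff)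
  fix q a assume a: "a \<in> simplex_basis l q"
  then have a': "frag_of a \<in> simplex_chains l q" by (simp add: simplex_chains_def)
  show "chain_nonneg (zdelta_act (zdelta_comp x y) (frag_of a))"
    unfolding zdelta_act_comp[OF xy a']
    using x y a' by (intro chain_nonneg_zdelta_act[OF x] zdelta_act_in_chains[OF xy(2)] chain_nonneg_zdelta_act[OF y]) auto
qed

section \<open>Monotone maps and their jumps\<close>

text \<open>The least argument of each value of a monotone \<open>f\<close>. The argument 0 always
  counts, which gives simplexes with first vertex 0.\<close>

definition jumps :: "nat list \<Rightarrow> nat list" where
  "jumps f = filter (\<lambda>i. i = 0 \<or> f ! (i - 1) \<noteq> f ! i) [0..<length f]"

lemma Delta_nth_mono: "f \<in> Delta m n \<Longrightarrow> i \<le> j \<Longrightarrow> j \<le> m \<Longrightarrow> f ! i \<le> f ! j"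
  by (auto simp: Delta_def sorted_iff_nth_mono)

lemma jumps_Cons: "f \<in> Delta m n \<Longrightarrow> \<exists>t. jumps f = 0 # t"
  by (auto simp: jumps_def Delta_def upt_conv_Cons simp del: upt_Suc)

lemma sorted_jumps: "sorted_wrt (<) (jumps f)"
  unfolding jumps_def by (rule sorted_wrt_filter) simp

lemma jumps_in_simplex_basis:
  assumes "f \<in> Delta m n"
  shows "jumps f \<in> simplex_basis m (length (jumps f) - 1)"
proof -
  have "set (jumps f) \<subseteq> {0..m}"
    using assms by (auto simp: jumps_def Delta_def)
  then show ?thesis
    using sorted_jumps[of f] jumps_Cons[OF assms] by (auto simp: simplex_basis_def)
qed

lemma sorted_map_jumps:
  assumes "f \<in> Delta m n"
  shows "sorted_wrt (<) (map (\<lambda>i. f ! i) (jumps f))"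
  unfolding sorted_wrt_map
proof (rule sorted_wrt_mono_rel[OF _ sorted_jumps])
  fix i j assume "i \<in> set (jumps f)" "j \<in> set (jumps f)" "i < j"
  then have j: "j \<le> m" "f ! (j - 1) \<noteq> f ! j" "i \<le> j - 1"
    using assms by (auto simp: jumps_def Delta_def)
  have "f ! i \<le> f ! (j - 1)" using Delta_nth_mono[OF assms j(3)] j(1) by simp
  also have "\<dots> < f ! j"
    using Delta_nth_mono[OF assms, of "j - 1" j] j by simp
  finally show "f ! i < f ! j" .
qed

lemma jumps_witness:
  assumes "j < length f"
  shows "\<exists>i\<le>j. i \<in> set (jumps f) \<and> f ! i = f ! j"
  using assms
proof (induction j)
  case 0
  then show ?case by (auto simp: jumps_def)
next
  case (Suc j)
  show ?case
  proof (cases "f ! j = f ! Suc j")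
    case True
    with Suc show ?thesis by (metis Suc_lessD le_SucI)
  next
    case False
    with Suc show ?thesis by (auto simp: jumps_def intro!: exI[of _ "Suc j"])
  qed
qed

text \<open>Between jumps \<open>f\<close> is constant while \<open>f'\<close> can only grow, so
  \<open>f\<close> is pointwise least among the maps with its values at its jumps.\<close>

lemma jumps_least:
  assumes f: "f \<in> Delta m n" and f': "f' \<in> Delta m n"
    and eq: "map (\<lambda>i. f' ! i) (jumps f) = map (\<lambda>i. f ! i) (jumps f)"
  shows "f' = f \<or> sum_list f < sum_list f'"
proof -
  have len: "length f = Suc m" "length f' = Suc m" using f f' by (auto simp: Delta_def)
  have le: "f ! j \<le> f' ! j" if "j < Suc m" for j
  proof -
    obtain i where i: "i \<le> j" "i \<in> set (jumps f)" "f ! i = f ! j"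
      using jumps_witness[of j f] \<open>j < Suc m\<close> len by auto
    have "f' ! i = f ! i" using eq i(2) by (meson map_eq_conv)
    with i Delta_nth_mono[OF f' i(1)] \<open>j < Suc m\<close> show ?thesis by simp
  qed
  show ?thesis
  proof (cases "f' = f")
    case False
    then obtain j where "j < Suc m" "f ! j \<noteq> f' ! j" using len by (metis nth_equalityI)
    then have "f ! j < f' ! j" using le[of j] by simp
    with \<open>j < Suc m\<close> have "(\<Sum>i<Suc m. f ! i) < (\<Sum>i<Suc m. f' ! i)"
      by (intro sum_strict_mono_ex1) (auto intro: le bexI[of _ j])
    then show ?thesis by (simp add: sum_list_sum_nth len atLeast0LessThan)
  qed simp
qed

lemma step_function_exists:
  assumes a: "a \<in> simplex_basis m q" and a0: "hd a = 0" and g: "g \<in> simplex_basis n q"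
  obtains f where "f \<in> Delta m n" "jumps f = a" "map (\<lambda>i. f ! i) (jumps f) = g"
proof -
  \<comment> \<open>The number of vertices of \<open>a\<close> up to \<open>i\<close>. It is at
    least 1 because 0 is a vertex, so \<open>c i - 1\<close> is the position of the last vertex
    reached.\<close>
  define c where "c i = card {j \<in> set a. j \<le> i}" for i
  define f where "f = map (\<lambda>i. g ! (c i - 1)) [0..<Suc m]"
  have la: "length a = Suc q" "sorted_wrt (<) a" "set a \<subseteq> {0..m}" "0 \<in> set a"
    using a by (auto simp: simplex_basis_def intro: hd_in_set[of a, unfolded a0])
  have lg: "length g = Suc q" "sorted_wrt (<) g" "set g \<subseteq> {0..n}"
    using g by (auto simp: simplex_basis_def)
  have card_a: "card (set a) = Suc q"
    using la distinct_card[of a] by (simp add: strict_sorted_iff)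
  have c_le: "c i \<le> Suc q" for i
    unfolding c_def card_a[symmetric] by (intro card_mono) auto
  have c_0: "c 0 = 1"
  proof -
    have "{j \<in> set a. j \<le> 0} = {0}" using la(4) by auto
    then show ?thesis by (simp add: c_def)
  qed
  have c_Suc: "c (Suc i) = (if Suc i \<in> set a then Suc (c i) else c i)" for i
  proof -
    have "{j \<in> set a. j \<le> Suc i} =
        (if Suc i \<in> set a then insert (Suc i) {j \<in> set a. j \<le> i} else {j \<in> set a. j \<le> i})"
      by (auto simp: le_Suc_eq)
    then show ?thesis by (simp add: c_def)
  qed
  have c_mono: "c i \<le> c j" if "i \<le> j" for i j
    unfolding c_def using that by (intro card_mono) auto
  have c_pos: "0 < c i" for i
    using c_mono[of 0 i] c_0 by simp
  have g_less: "g ! i < g ! j" if "i < j" "j \<le> q" for i j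
    using lg that by (simp add: sorted_wrt_iff_nth_less)
  have a_less: "a ! i < a ! j" if "i < j" "j \<le> q" for i j
    using la that by (simp add: sorted_wrt_iff_nth_less)
  have f_nth: "f ! i = g ! (c i - 1)" if "i \<le> m" for i
    using that by (simp add: f_def del: upt_Suc)
  have f: "f \<in> Delta m n"
    unfolding Delta_def
  proof (intro CollectI conjI)
    show len: "length f = Suc m" by (simp add: f_def)
    show "sorted f"
      unfolding sorted_iff_nth_mono
    proof (intro allI impI)
      fix i j assume ij: "i \<le> j" "j < length f"
      then have "c i - 1 \<le> c j - 1" "c j - 1 \<le> q"
        using c_mono[of i j] c_le[of j] by auto
      then have "g ! (c i - 1) \<le> g ! (c j - 1)"
        using g_less[of "c i - 1" "c j - 1"] by (cases "c i - 1 = c j - 1") auto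
      then show "f ! i \<le> f ! j" using ij len by (simp add: f_nth)
    qed
    have "g ! (c i - 1) \<le> n" for i
      using lg c_le[of i] nth_mem[of "c i - 1" g] by fastforce
    then show "set f \<subseteq> {0..n}" by (auto simp: f_def)
  qed
  have jump: "i = 0 \<or> f ! (i - 1) \<noteq> f ! i \<longleftrightarrow> i \<in> set a" if "i \<le> m" for i
  proof (cases i)
    case 0
    then show ?thesis using la by simp
  next
    case (Suc k)
    have "g ! (c k - 1) < g ! (c k)" if "Suc k \<in> set a"
      using that c_pos[of k] c_le[of "Suc k"] by (intro g_less) (auto simp: c_Suc)
    then show ?thesis using that Suc by (auto simp: f_nth c_Suc)
  qed
  have "set (jumps f) = set a"
  proof -
    have "set (jumps f) = {i. i \<le> m \<and> (i = 0 \<or> f ! (i - 1) \<noteq> f ! i)}"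
      using f by (auto simp: jumps_def Delta_def simp del: upt_Suc)
    also have "\<dots> = {i. i \<le> m \<and> i \<in> set a}"
      using jump by blast
    finally show ?thesis using la(3) by auto
  qed
  then have ja: "jumps f = a"
    using sorted_jumps[of f] la(2) by (intro strict_sorted_equal) auto
  have "map (\<lambda>i. f ! i) a = g"
  proof (rule nth_equalityI)
    fix k assume "k < length (map (\<lambda>i. f ! i) a)"
    then have k: "k < Suc q" using la by simp
    have less_iff: "a ! i \<le> a ! k \<longleftrightarrow> i \<le> k" if "i < Suc q" for i
      using that k a_less[of i k] a_less[of k i] by (cases i k rule: linorder_cases) auto
    have "{j \<in> set a. j \<le> a ! k} = (!) a ` {..k}"
    proof -
      have "set a = (!) a ` {..<Suc q}" using la(1) by (auto simp: set_conv_nth)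
      then show ?thesis using less_iff k by auto
    qed
    moreover have "inj_on ((!) a) {..k}"
      using la k by (intro inj_on_nth) (auto simp: strict_sorted_iff)
    ultimately have "c (a ! k) = Suc k" by (simp add: c_def card_image)
    moreover have "a ! k \<le> m" using la k nth_mem[of k a] by fastforce
    ultimately show "map (\<lambda>i. f ! i) a ! k = g ! k"
      using k la by (simp add: f_nth)
  qed (use la lg in simp)
  with that f ja show ?thesis by metis
qed

lemma finite_Delta: "finite (Delta m n)"
  by (rule finite_subset[OF _ finite_lists_length_eq[of "{0..n}" "Suc m"]]) (auto simp: Delta_def)

section \<open>Chain maps between simplexes\<close>

text \<open>Let \<open>f\<close> have maximal sum of entries in the support. Any other map that
  agrees with \<open>f\<close> on \<open>jumps f\<close> has a larger sum, so the coefficient of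
  \<open>f\<close> can be read off on this simplex.\<close>

lemma zdelta_act_faithful:
  assumes x: "x \<in> ZDelta m n"
    and zero: "\<And>q a. a \<in> simplex_basis m q \<Longrightarrow> zdelta_act x (frag_of a) = 0"
  shows "x = 0"
proof (rule ccontr)
  assume "x \<noteq> 0"
  then have ne: "Poly_Mapping.keys x \<noteq> {}" by simp
  have "Max (sum_list ` Poly_Mapping.keys x) \<in> sum_list ` Poly_Mapping.keys x"
    using ne by (intro Max_in) auto
  then obtain f where f: "f \<in> Poly_Mapping.keys x" "sum_list f = Max (sum_list ` Poly_Mapping.keys x)"
    by auto
  have max: "sum_list f' \<le> sum_list f" if "f' \<in> Poly_Mapping.keys x" for f'
    unfolding f(2) using that by (intro Max_ge) auto
  have D: "f' \<in> Delta m n" if "f' \<in> Poly_Mapping.keys x" for f'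
    using that x by (auto simp: ZDelta_def)
  let ?g = "map (\<lambda>i. f ! i) (jumps f)"
  have "map (\<lambda>i. f' ! i) (jumps f) = ?g \<longleftrightarrow> f' = f" if "f' \<in> Poly_Mapping.keys x" for f'
    using jumps_least[OF D[OF f(1)] D[OF that]] max[OF that] by fastforce
  then have "Poly_Mapping.lookup (zdelta_act x (frag_of (jumps f))) ?g =
      (\<Sum>f'\<in>Poly_Mapping.keys x. Poly_Mapping.lookup x f' * (if f' = f then 1 else 0))"
    unfolding lookup_zdelta_act[OF sorted_map_jumps[OF D[OF f(1)]]] by (intro sum.cong) auto
  also have "\<dots> = Poly_Mapping.lookup x f"
    using f(1) by (simp add: if_distrib cong: if_cong)
  finally show False
    using zero[OF jumps_in_simplex_basis[OF D[OF f(1)]]] f(1) by (simp add: in_keys_iff)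
qed

text \<open>The matrix of this system of equations is unitriangular with respect to the sum of the
  entries of a map.\<close>

lemma zdelta_act_prescribed:
  fixes t :: "nat list \<Rightarrow> int"
  assumes "T \<subseteq> Delta m n"
  shows "\<exists>x. Poly_Mapping.keys x \<subseteq> T \<and>
    (\<forall>f\<in>T. Poly_Mapping.lookup (zdelta_act x (frag_of (jumps f))) (map (\<lambda>i. f ! i) (jumps f)) = t f)"
proof -
  let ?L = "\<lambda>f x. Poly_Mapping.lookup (zdelta_act x (frag_of (jumps f))) (map (\<lambda>i. f ! i) (jumps f))"
  have "finite T" using assms finite_Delta finite_subset by blast
  then have "T \<subseteq> Delta m n \<Longrightarrow> \<exists>x. Poly_Mapping.keys x \<subseteq> T \<and> (\<forall>f\<in>T. ?L f x = t f)"
  \<comment> \<open>The inserted \<open>f\<close> has the largest sum, so its own equation does not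
    involve the other maps in \<open>T\<close>.\<close>
  proof (induction T arbitrary: t rule: finite_ranking_induct[where f = sum_list])
    case empty
    show ?case by (intro exI[of _ 0]) simp
  next
    case (insert f T)
    show ?case
    proof (cases "f \<in> T")
      case True
      with insert show ?thesis by (simp add: insert_absorb)
    next
      case False
      have f: "f \<in> Delta m n" using insert.prems by simp
      \<comment> \<open>The targets on \<open>T\<close> are corrected in advance for the
        contribution of \<open>f\<close>, whose coefficient will be \<open>t f\<close>.\<close>
      define r where "r = (\<lambda>f'. t f' - t f * ?L f' (frag_of f))"
      obtain x where x: "Poly_Mapping.keys x \<subseteq> T" "\<forall>f'\<in>T. ?L f' x = r f'"
        using insert.IH[of r] insert.prems by auto
      define y where "y = x + frag_cmul (t f) (frag_of f)"
      have lin: "?L f' y = ?L f' x + t f * ?L f' (frag_of f)" for f'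
        unfolding y_def by (simp add: lookup_add)
      have "?L f x = 0"
        unfolding lookup_zdelta_act[OF sorted_map_jumps[OF f]]
      proof (intro sum.neutral ballI)
        fix f' assume "f' \<in> Poly_Mapping.keys x"
        then have "f' \<in> T" using x by auto
        with insert.prems insert.hyps False have "f' \<in> Delta m n" "f' \<noteq> f" "\<not> sum_list f < sum_list f'"
          by (auto simp: not_less)
        with jumps_least[OF f]
        show "Poly_Mapping.lookup x f' *
            (if map (\<lambda>i. f' ! i) (jumps f) = map (\<lambda>i. f ! i) (jumps f) then 1 else 0) = 0"
          by auto
      qed
      moreover have "?L f (frag_of f) = 1"
        using sorted_map_jumps[OF f] by (simp add: delta_act_basis_def)
      ultimately have "?L f y = t f" by (simp only: lin)
      moreover have "?L f' y = t f'" if "f' \<in> T" for f'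
        using x that unfolding lin by (simp add: r_def)
      moreover have "Poly_Mapping.keys y \<subseteq> insert f T"
        using x(1) keys_add[of x "frag_cmul (t f) (frag_of f)"] keys_cmul[of "t f" "frag_of f"]
        unfolding y_def by auto
      ultimately show ?thesis by blast
    qed
  qed
  with assms show ?thesis by blast
qed

text \<open>Every simplex \<open>b\<close> not containing the vertex 0 is the boundary of \<open>0 # b\<close> up to simplexes
  with first vertex 0; hence it suffices to match the values on the latter.\<close>

lemma chain_map_representable:
  assumes \<phi>: "\<And>q a. a \<in> simplex_basis m q \<Longrightarrow> \<phi> a \<in> simplex_chains n q"
    and bd: "\<And>q a. a \<in> simplex_basis m (Suc q) \<Longrightarrow>
      simplex_boundary (\<phi> a) = frag_extend \<phi> (simplex_boundary (frag_of a))"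
  obtains x where "x \<in> ZDelta m n" "\<forall>q. \<forall>a\<in>simplex_basis m q. zdelta_act x (frag_of a) = \<phi> a"
proof -
  obtain x where keys_x: "Poly_Mapping.keys x \<subseteq> Delta m n" and
    x: "\<forall>f\<in>Delta m n. Poly_Mapping.lookup (zdelta_act x (frag_of (jumps f))) (map (\<lambda>i. f ! i) (jumps f))
      = Poly_Mapping.lookup (\<phi> (jumps f)) (map (\<lambda>i. f ! i) (jumps f))"
    using zdelta_act_prescribed[OF order_refl,
        of m n "\<lambda>f. Poly_Mapping.lookup (\<phi> (jumps f)) (map (\<lambda>i. f ! i) (jumps f))"]
    by auto
  have xZ: "x \<in> ZDelta m n" using keys_x by (simp add: ZDelta_def)
  have chain: "frag_of a \<in> simplex_chains m q" if "a \<in> simplex_basis m q" for a q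
    using that by (simp add: simplex_chains_def)
  have first0: "zdelta_act x (frag_of a) = \<phi> a" if a: "a \<in> simplex_basis m q" "hd a = 0" for a q
  proof (rule poly_mapping_eqI)
    fix g
    show "Poly_Mapping.lookup (zdelta_act x (frag_of a)) g = Poly_Mapping.lookup (\<phi> a) g"
    proof (cases "g \<in> simplex_basis n q")
      case True
      obtain f where "f \<in> Delta m n" "jumps f = a" "map (\<lambda>i. f ! i) (jumps f) = g"
        using step_function_exists[OF a True] .
      with x show ?thesis by metis
    next
      case False
      then have "g \<notin> Poly_Mapping.keys (\<phi> a)" "g \<notin> Poly_Mapping.keys (zdelta_act x (frag_of a))"
        using \<phi>[OF a(1)] zdelta_act_in_chains[OF xZ chain[OF a(1)]]
        by (auto simp: simplex_chains_def)
      then show ?thesis by (simp add: in_keys_iff)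
    qed
  qed
  have "zdelta_act x (frag_of b) = \<phi> b" if b: "b \<in> simplex_basis m q" for b q
  proof (cases "hd b = 0")
    case True
    with first0 b show ?thesis by blast
  next
    case False
    have pos: "0 < i" if "i \<in> set b" for i
      using b False that by (cases b) (auto simp: simplex_basis_def)
    then have b0: "0 # b \<in> simplex_basis m (Suc q)"
      using b by (auto simp: simplex_basis_def)
    let ?c = "cone 0 (simplex_boundary (frag_of b))"
    have "zdelta_act x ?c = frag_extend \<phi> ?c"
      unfolding zdelta_act_extend[of x ?c]
    proof (rule frag_extend_eq)
      fix a assume "a \<in> Poly_Mapping.keys ?c"
      then obtain g where g: "a = 0 # g" "g \<in> Poly_Mapping.keys (simplex_boundary (frag_of b))"
        by (auto simp: keys_cone)
      have "Suc (length g) = length b" "sorted_wrt (<) g" "set g \<subseteq> set b"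
        using keys_simplex_boundary[OF g(2)] b by (auto simp: simplex_basis_def)
      then have "a \<in> simplex_basis m q" "hd a = 0"
        using b pos by (auto simp: simplex_basis_def g(1))
      then show "zdelta_act x (frag_of a) = \<phi> a" by (rule first0)
    qed
    moreover have "zdelta_act x (simplex_boundary (frag_of (0 # b))) =
        frag_extend \<phi> (simplex_boundary (frag_of (0 # b)))"
      using zdelta_act_boundary[OF xZ chain[OF b0]] bd[OF b0] first0[OF b0] by simp
    ultimately show ?thesis
      by (simp add: simplex_boundary_Cons frag_extend_diff)
  qed
  with that xZ show ?thesis by blast
qed

section \<open>Morphisms of orientals\<close>

lemma omega_hom_oriental_iff:
  "F \<in> omega_hom (oriental m) (oriental n) \<longleftrightarrow>
    F \<in> oriental_mor m \<rightarrow>\<^sub>E oriental_mor n \<and>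
    (\<forall>x\<in>oriental_mor m. \<forall>s p. F (oriental_bd s p x) = oriental_bd s p (F x)) \<and>
    (\<forall>x\<in>oriental_mor m. \<forall>y\<in>oriental_mor m. \<forall>p. oriental_bd Plus p x = oriental_bd Minus p y \<longrightarrow>
      F (oriental_comp p x y) = oriental_comp p (F x) (F y))"
  by (simp add: omega_hom_def oriental_is_omega_category)

lemma zdelta_act_oriental_mor:
  assumes x: "x \<in> oriental_coeffs m n" and u: "u \<in> oriental_mor m"
  shows "(\<lambda>s q. zdelta_act x (u s q)) \<in> oriental_mor n"
proof -
  note D = oriental_morD[OF u]
  have xZ: "x \<in> ZDelta m n" "coeff_sum x = 1" using x by (auto simp: oriental_coeffs_iff)
  obtain N where N: "\<And>s q. N < q \<Longrightarrow> u s q = 0"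
    using u by (auto simp: oriental_mor_def)
  show ?thesis
  proof (rule oriental_morI[where N = N])
    fix s q
    show "zdelta_act x (u s q) \<in> simplex_chains n q"
      using zdelta_act_in_chains[OF xZ(1) D(1)] .
    show "chain_nonneg (zdelta_act x (u s q))"
      using chain_nonneg_zdelta_act[OF x D(1) D(2)] .
    show "coeff_sum (zdelta_act x (u s 0)) = 1"
      using coeff_sum_zdelta_act[OF D(1)] by (simp add: xZ D)
    show "simplex_boundary (zdelta_act x (u s (Suc q))) = zdelta_act x (u Plus q) - zdelta_act x (u Minus q)"
      by (simp add: zdelta_act_boundary[OF xZ(1) D(1), symmetric] D(4))
    show "zdelta_act x (u s q) = 0" if "N < q"
      using that by (simp add: N)
  qed
qed

lemma oriental_map_apply:
  "u \<in> oriental_mor m \<Longrightarrow> oriental_map m x u = (\<lambda>s q. zdelta_act x (u s q))"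
  by (simp add: oriental_map_def)

lemma oriental_map_in_omega_hom:
  assumes x: "x \<in> oriental_coeffs m n"
  shows "oriental_map m x \<in> omega_hom (oriental m) (oriental n)"
  unfolding omega_hom_oriental_iff
proof (intro conjI ballI allI impI)
  show "oriental_map m x \<in> oriental_mor m \<rightarrow>\<^sub>E oriental_mor n"
    using zdelta_act_oriental_mor[OF x] by (auto simp: oriental_map_def)
  fix u assume u: "u \<in> oriental_mor m"
  show "oriental_map m x (oriental_bd s p u) = oriental_bd s p (oriental_map m x u)" for s p
    unfolding oriental_map_apply[OF u] oriental_map_apply[OF oriental_bd_closed[OF u]]
    by (auto simp: oriental_bd_def fun_eq_iff)
  fix v p assume v: "v \<in> oriental_mor m" and c: "oriental_bd Plus p u = oriental_bd Minus p v"
  show "oriental_map m x (oriental_comp p u v) = oriental_comp p (oriental_map m x u) (oriental_map m x v)"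
    unfolding oriental_map_apply[OF u] oriental_map_apply[OF v] oriental_map_apply[OF oriental_comp_closed[OF u v c]]
    by (auto simp: oriental_comp_def oriental_bd_def fun_eq_iff)
qed

text \<open>For a morphism \<open>F\<close> both signs give the same entry in this degree, so the
  choice of \<open>Plus\<close> is arbitrary.\<close>

definition hom_chain :: "(double_seq \<Rightarrow> double_seq) \<Rightarrow> nat list \<Rightarrow> (nat list \<Rightarrow>\<^sub>0 int)" where
  "hom_chain F e = F (atom_cell e) Plus (length e - 1)"

text \<open>For an atom, the entries below the top degree occur in boundary cells of smaller
  dimension, the top entry defines \<open>hom_chain\<close>, and the entries above vanish because
  \<open>F\<close> preserves the fact that the atom is its own boundary in its top degree.\<close>

lemma omega_hom_determined:
  assumes F: "F \<in> omega_hom (oriental m) (oriental n)" and x: "x \<in> oriental_mor m"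
  shows "F x s q = frag_extend (hom_chain F) (x s q)"
proof -
  let ?P = "\<lambda>x. \<forall>s q. F x s q = frag_extend (hom_chain F) (x s q)"
  have F_bd: "F (oriental_bd s p x) = oriental_bd s p (F x)" if "x \<in> oriental_mor m" for x s p
    using F that by (auto simp: omega_hom_oriental_iff)
  have F_comp: "F (oriental_comp p y z) = oriental_comp p (F y) (F z)"
    if "y \<in> oriental_mor m" "z \<in> oriental_mor m" "oriental_bd Plus p y = oriental_bd Minus p z" for p y z
    using F that by (auto simp: omega_hom_oriental_iff)
  have "?P x" if "x \<in> oriental_mor m" "\<And>s q. d < q \<Longrightarrow> x s q = 0" for d x
    using that
  proof (induction d arbitrary: x rule: less_induct)
    case (less d)
    show ?case
    proof (rule oriental_generation[of x m d ?P, OF less.prems])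
      fix e assume e: "e \<in> simplex_basis m (length e - 1)" "length e \<le> Suc d"
      define r where "r = length e - 1"
      have len: "length e = Suc r" using e by (auto simp: simplex_basis_def r_def)
      note a = atom_cell_in_oriental_mor[OF e(1)]
      have top: "atom_cell e t r = frag_of e" for t
        by (simp add: atom_cell_def len[symmetric])
      have above: "atom_cell e t q = 0" if "r < q" for t q
        using that by (simp add: atom_cell_def atom_above len)
      have "oriental_bd t r (atom_cell e) = atom_cell e" for t
        by (auto simp: fun_eq_iff oriental_bd_def top above)
      then have Fe: "F (atom_cell e) = oriental_bd t r (F (atom_cell e))" for t
        using F_bd[OF a] by metis
      show "?P (atom_cell e)"
      proof (intro allI)
        fix s q
        consider "q < r" | "q = r" | "r < q" by linarith
        then show "F (atom_cell e) s q = frag_extend (hom_chain F) (atom_cell e s q)"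
        proof cases
          case 1
          then have "q < d" using e(2) len by simp
          \<comment> \<open>This boundary has dimension below \<open>d\<close> and keeps the entry
            of sign \<open>s\<close> in degree \<open>q\<close>.\<close>
          have "F (oriental_bd s q (atom_cell e)) s q =
              frag_extend (hom_chain F) (oriental_bd s q (atom_cell e) s q)"
            using less.IH[OF \<open>q < d\<close> oriental_bd_closed[OF a]] by (simp add: oriental_bd_def)
          then show ?thesis unfolding F_bd[OF a] by (simp add: oriental_bd_def)
        next
          case 2
          have "F (atom_cell e) s r = oriental_bd Plus r (F (atom_cell e)) s r"
            using Fe[of Plus] by simp
          also have "\<dots> = F (atom_cell e) Plus r"
            by (simp add: oriental_bd_def)
          finally show ?thesis
            using 2 by (simp add: top hom_chain_def len)
        next
          case 3
          have "F (atom_cell e) s q = oriental_bd Plus r (F (atom_cell e)) s q"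
            using Fe[of Plus] by simp
          then show ?thesis using 3 by (simp add: oriental_bd_def above)
        qed
      qed
    next
      fix p y z
      assume yz: "y \<in> oriental_mor m" "z \<in> oriental_mor m"
        "oriental_bd Plus p y = oriental_bd Minus p z" "?P y" "?P z"
      show "?P (oriental_comp p y z)"
        unfolding F_comp[OF yz(1-3)] using yz(4,5)
        by (auto simp: oriental_comp_def oriental_bd_def frag_extend_add frag_extend_diff)
    qed
  qed
  moreover obtain N where "\<And>s q. N < q \<Longrightarrow> x s q = 0"
    using x by (auto simp: oriental_mor_def)
  ultimately show ?thesis using x by blast
qed

lemma oriental_map_surj:
  assumes F: "F \<in> omega_hom (oriental m) (oriental n)"
  obtains x where "x \<in> oriental_coeffs m n" "oriental_map m x = F"
proof -
  let ?\<phi> = "hom_chain F"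
  have FE: "F \<in> oriental_mor m \<rightarrow>\<^sub>E oriental_mor n"
    using F by (simp add: omega_hom_oriental_iff)
  have \<phi>: "?\<phi> a = F (atom_cell a) Plus q" "F (atom_cell a) \<in> oriental_mor n"
    if "a \<in> simplex_basis m q" for a q
    using that FE atom_cell_in_oriental_mor[OF that] by (auto simp: hom_chain_def simplex_basis_def)
  have chains: "?\<phi> a \<in> simplex_chains n q" if "a \<in> simplex_basis m q" for a q
    using oriental_morD(1)[OF \<phi>(2)[OF that]] \<phi>(1)[OF that] by simp
  have bd: "simplex_boundary (?\<phi> a) = frag_extend ?\<phi> (simplex_boundary (frag_of a))"
    if a: "a \<in> simplex_basis m (Suc q)" for a q
  proof -
    have top: "frag_of a = atom_cell a Plus (Suc q)"
      using a by (auto simp: atom_cell_def simplex_basis_def simp flip: atom_top[of Plus a])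
    have "simplex_boundary (?\<phi> a) = F (atom_cell a) Plus q - F (atom_cell a) Minus q"
      using oriental_morD(4)[OF \<phi>(2)[OF a]] \<phi>(1)[OF a] by simp
    also have "\<dots> = frag_extend ?\<phi> (atom_cell a Plus q - atom_cell a Minus q)"
      by (simp add: omega_hom_determined[OF F atom_cell_in_oriental_mor[OF a]] frag_extend_diff)
    also have "atom_cell a Plus q - atom_cell a Minus q = simplex_boundary (frag_of a)"
      unfolding top by (rule oriental_morD(4)[OF atom_cell_in_oriental_mor[OF a], symmetric])
    finally show ?thesis .
  qed
  obtain x where xZ: "x \<in> ZDelta m n"
    and "\<forall>q. \<forall>a\<in>simplex_basis m q. zdelta_act x (frag_of a) = ?\<phi> a"
    by (rule chain_map_representable[of m ?\<phi> n, OF chains bd])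
  then have x: "zdelta_act x (frag_of a) = ?\<phi> a" if "a \<in> simplex_basis m q" for a q
    using that by blast
  have "x \<in> oriental_coeffs m n"
    unfolding oriental_coeffs_iff
  proof (intro conjI allI ballI xZ)
    \<comment> \<open>Evaluation at a vertex recovers the coefficient sum as an augmentation;
      \<open>[0]\<close> is available for every \<open>m\<close>.\<close>
    have v: "[0] \<in> simplex_basis m 0" by (simp add: simplex_basis_def)
    have "coeff_sum x = coeff_sum (zdelta_act x (frag_of [0]))"
      using v by (subst coeff_sum_zdelta_act[of _ m]) (auto simp: simplex_chains_def)
    also have "\<dots> = 1"
      using oriental_morD(3)[OF \<phi>(2)[OF v]] \<phi>(1)[OF v] by (simp add: x[OF v])
    finally show "coeff_sum x = 1" .
    show "chain_nonneg (zdelta_act x (frag_of a))" if "a \<in> simplex_basis m l" for l a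
      using oriental_morD(2)[OF \<phi>(2)[OF that]] \<phi>(1)[OF that] by (simp add: x[OF that])
  qed
  moreover have "oriental_map m x = F"
  proof (rule ext)
    fix u
    show "oriental_map m x u = F u"
    proof (cases "u \<in> oriental_mor m")
      case True
      have "zdelta_act x (u s q) = frag_extend ?\<phi> (u s q)" for s q
        unfolding zdelta_act_extend[of x "u s q"] using oriental_morD(1)[OF True, of s q]
        by (intro frag_extend_eq x[of _ q]) (auto simp: simplex_chains_def)
      then show ?thesis
        unfolding oriental_map_apply[OF True]
        by (intro ext) (simp only: omega_hom_determined[OF F True])
    next
      case False
      \<comment> \<open>Outside the set of cells both functions take the value
        \<open>undefined\<close>.\<close>
      then show ?thesis by (simp add: oriental_map_def PiE_arb[OF FE])
    qed
  qed
  ultimately show ?thesis using that by blast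
qed

text \<open>Each simplex is the top entry of its atom, so a morphism determines the action on all
  simplexes.\<close>

lemma oriental_map_inj:
  assumes "x \<in> oriental_coeffs m n" "y \<in> oriental_coeffs m n" "oriental_map m x = oriental_map m y"
  shows "x = y"
proof -
  have "x - y = 0"
  proof (rule zdelta_act_faithful[of _ m n])
    show "x - y \<in> ZDelta m n"
      using assms keys_diff[of x y] by (auto simp: oriental_coeffs_iff ZDelta_def)
    fix q a assume a: "a \<in> simplex_basis m q"
    then have "atom_cell a Plus q = frag_of a"
      by (auto simp: atom_cell_def simplex_basis_def simp flip: atom_top[of Plus a])
    moreover have "zdelta_act x (atom_cell a Plus q) = zdelta_act y (atom_cell a Plus q)"
      using fun_cong[OF assms(3), of "atom_cell a"] atom_cell_in_oriental_mor[OF a]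
      by (simp add: oriental_map_apply fun_eq_iff)
    ultimately show "zdelta_act (x - y) (frag_of a) = 0" by simp
  qed
  then show ?thesis by simp
qed

theorem theorem4p2:
  fixes m n :: nat
  shows "bij_betw (oriental_map m) (oriental_coeffs m n) (omega_hom (oriental m) (oriental n))
    \<and> (\<forall>l. \<forall>x\<in>oriental_coeffs m n. \<forall>y\<in>oriental_coeffs l m.
          zdelta_comp x y \<in> oriental_coeffs l n
          \<and> oriental_map l (zdelta_comp x y)
              = compose (mor (oriental l)) (oriental_map m x) (oriental_map l y))"
proof (intro conjI allI ballI)
  show "bij_betw (oriental_map m) (oriental_coeffs m n) (omega_hom (oriental m) (oriental n))"
    unfolding bij_betw_def inj_on_def
    using oriental_map_inj oriental_map_in_omega_hom oriental_map_surj by blast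
next
  fix l x y assume x: "x \<in> oriental_coeffs m n" and y: "y \<in> oriental_coeffs l m"
  then show "zdelta_comp x y \<in> oriental_coeffs l n" by (rule zdelta_comp_in_oriental_coeffs)
  show "oriental_map l (zdelta_comp x y) = compose (mor (oriental l)) (oriental_map m x) (oriental_map l y)"
  proof (rule ext)
    fix u
    show "oriental_map l (zdelta_comp x y) u = compose (mor (oriental l)) (oriental_map m x) (oriental_map l y) u"
    proof (cases "u \<in> oriental_mor l")
      case True
      have "zdelta_act (zdelta_comp x y) (u s q) = zdelta_act x (zdelta_act y (u s q))" for s q
        using x y oriental_morD(1)[OF True] by (intro zdelta_act_comp) (auto simp: oriental_coeffs_iff)
      then show ?thesis
        using True zdelta_act_oriental_mor[OF y True] by (simp add: compose_def oriental_map_apply)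
    qed (simp add: compose_def oriental_map_def)
  qed
qed

end
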